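(* Let $\mathfrak h=\mathfrak g\ltimes_\rho V$ be a semi-direct product equipped with an integrable complex structure $J$ that is totally real with respect to the semi-direct product (in particular $J\mathfrak g=V$). Let $\mathfrak h^\vee=\mathfrak g\ltimes_{\rho^*}V^*$ be the dual semi-direct product, with the symplectic form $\omega_J(x+u,y+v)=v(Jx)-u(Jy)$ for $x,y\in\mathfrak g$, $u,v\in V^*$. Then the differential Gerstenhaber algebras $\mathrm{DGA}(\mathfrak h,J)$ and $\mathrm{DGA}(\mathfrak h^\vee,\omega_J)$ are isomorphic.
   Context: All Lie algebras are finite dimensional and real unless complexified. For a Lie algebra $\mathfrak g$ and a representation $\rho:\mathfrak g\to\mathrm{End}(V)$, $\mathfrak g\ltimes_\rho V$ is the vector space $\mathfrak g\oplus V$ with bracket $[x+u,y+v]=[x,y]+\rho(x)v-\rho(y)u$. The dual semi-direct product is $\mathfrak g\ltimes_{\rho^*}V^*$ with $(\rho^*(x)a)(u)=-a(\rho(x)u)$. A complex structure on $\mathfrak h$ is an endomorphism $J$ with $J^2=-1$; it is integrable if $[x,y]-[Jx,Jy]+J([x,Jy]+[Jx,y])=0$ for all $x,y\in\mathfrak h$. On $\mathfrak h=\mathfrak g\ltimes_\rho V$, $J$ is totally real if $J\mathfrak g=V$ (so $\mathfrak h=\mathfrak g\oplus J\mathfrak g$). The Chevalley-Eilenberg differential on 1-forms is $d\alpha(x,y)=-\alpha([x,y])$, extended as a derivation of the exterior algebra. $\mathrm{DGA}(\mathfrak h,J)$: let $\mathfrak h^{(1,0)},\mathfrak h^{(0,1)}\subset\mathfrak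 h_{\mathbb C}$ be the $\pm i$-eigenspaces of $J$, and $\mathfrak h^{*(1,0)},\mathfrak h^{*(0,1)}\subset\mathfrak h^*_{\mathbb C}$ the annihilators of $\mathfrak h^{(0,1)}$ and $\mathfrak h^{(1,0)}$ respectively. Put $\mathfrak f^1=\mathfrak h^{(1,0)}\oplus\mathfrak h^{*(0,1)}$ and $\overline{\mathfrak f}^1=\mathfrak h^{(0,1)}\oplus\mathfrak h^{*(1,0)}$; each is a complex Lie algebra under the Schouten bracket $[x+\alpha\bullet y+\beta]=[x,y]+\iota_xd\beta-\iota_yd\alpha$. The natural pairing $\langle x+\alpha,y+\beta\rangle=\alpha(y)+\beta(x)$ on $(\mathfrak h\oplus\mathfrak h^* )\otimes\mathbb C$ identifies $(\overline{\mathfrak f}^1)^*\cong\mathfrak f^1$, so the Chevalley-Eilenberg differential of the Lie algebra $\overline{\mathfrak f}^1$ becomes a differential $\bar\partial$ on $\wedge^\bullet\mathfrak f^1$. $\mathrm{DGA}(\mathfrak h,J)$ is $(\wedge^\bullet\mathfrak f^1,[-\bullet-],\wedge,\bar\partial)$, where the bracket is extended from $\mathfrak f^1$ to $\wedge^\bullet\mathfrak f^1$ in the usual way as a Gerstenhaber bracket (graded biderivation). $\mathrm{DGA}(\mathfrak k,\omega)$ for a Lie algebra $\mathfrak k$ with symplectic form $\omega$ (closed non-degenerate 2-form): regard $\omega$ as the isomorphism $\mathfrak k\to\mathfrak k^*$, $x\mapsto\omega(x,\cdot)$, and put $[\alpha\bullet\beta]_\omega=\omega([\omega^{-1}\alpha,\omega^{-1}\beta])$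 on $\mathfrak k^*$, extended to $\wedge^\bullet\mathfrak k^*$ as a Gerstenhaber bracket. $\mathrm{DGA}(\mathfrak k,\omega)$ is the complexification of $(\wedge^\bullet\mathfrak k^*,[-\bullet-]_\omega,\wedge,d)$ with $d$ the Chevalley-Eilenberg differential of $\mathfrak k$. An isomorphism of differential Gerstenhaber algebras is a complex linear bijection of degree zero that respects wedge product, bracket and differential. *)

theory Defs
  imports "HOL-Analysis.Analysis"
begin

section \<open>Dual spaces and complexifications\<close>

typedef (overloaded) 'a dual = "{f :: 'a::real_vector \<Rightarrow> real. linear f}"
  morphisms dual_app Dual
  by (intro exI[of _ "\<lambda>x. 0"]) (simp add: module_hom_zero)

setup_lifting type_definition_dual

instantiation dual :: (real_vector) real_vector
begin

lift_definition zero_dual :: "'a dual" is "\<lambda>x. 0"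
  by (simp add: module_hom_zero)
lift_definition plus_dual :: "'a dual \<Rightarrow> 'a dual \<Rightarrow> 'a dual" is "\<lambda>f g x. f x + g x"
  by (rule linear_compose_add)
lift_definition minus_dual :: "'a dual \<Rightarrow> 'a dual \<Rightarrow> 'a dual" is "\<lambda>f g x. f x - g x"
  by (rule linear_compose_sub)
lift_definition uminus_dual :: "'a dual \<Rightarrow> 'a dual" is "\<lambda>f x. - f x"
  by (rule linear_compose_neg)
lift_definition scaleR_dual :: "real \<Rightarrow> 'a dual \<Rightarrow> 'a dual" is "\<lambda>c f x. c * f x"
  using linear_compose_scale_right by fastforce

instance
  by standard (transfer; simp add: fun_eq_iff algebra_simps)+

end

text \<open>The complexification of a real vector space \<open>'a\<close>; the pair \<open>(x, y)\<close> stands for \<open>x + i y\<close>.\<close>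

type_synonym 'a cplx = "'a \<times> 'a"

fun cscale :: "complex \<Rightarrow> 'a::real_vector cplx \<Rightarrow> 'a cplx" where
  "cscale c (x, y) = (Re c *\<^sub>R x - Im c *\<^sub>R y, Re c *\<^sub>R y + Im c *\<^sub>R x)"

text \<open>The complex bilinear extension of a real bilinear map.\<close>

fun cbil :: "('a \<Rightarrow> 'b \<Rightarrow> 'c::ab_group_add) \<Rightarrow> 'a cplx \<Rightarrow> 'b cplx \<Rightarrow> 'c cplx" where
  "cbil f (x, y) (u, v) = (f x u - f y v, f x v + f y u)"

definition ceval :: "'a::real_vector dual cplx \<Rightarrow> 'a cplx \<Rightarrow> complex" where
  "ceval a z = (case cbil dual_app a z of (r, s) \<Rightarrow> Complex r s)"


section \<open>Lie algebras, representations, semi-direct products\<close>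

definition fin_dim :: "'a::real_vector itself \<Rightarrow> bool" where
  "fin_dim _ \<longleftrightarrow> (\<exists>B :: 'a set. finite B \<and> span B = UNIV)"

definition lie_algebra :: "('a::real_vector \<Rightarrow> 'a \<Rightarrow> 'a) \<Rightarrow> bool" where
  "lie_algebra br \<longleftrightarrow> fin_dim TYPE('a) \<and> bilinear br \<and> (\<forall>x. br x x = 0) \<and>
     (\<forall>x y z. br x (br y z) + br y (br z x) + br z (br x y) = 0)"

definition lie_representation ::
    "('g::real_vector \<Rightarrow> 'g \<Rightarrow> 'g) \<Rightarrow> ('g \<Rightarrow> 'v::real_vector \<Rightarrow> 'v) \<Rightarrow> bool" where
  "lie_representation br \<rho> \<longleftrightarrow> fin_dim TYPE('v) \<and> bilinear \<rho> \<and>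
     (\<forall>x y v. \<rho> (br x y) v = \<rho> x (\<rho> y v) - \<rho> y (\<rho> x v))"

fun semidirect ::
    "('g \<Rightarrow> 'g \<Rightarrow> 'g) \<Rightarrow> ('g \<Rightarrow> 'v \<Rightarrow> 'v::ab_group_add) \<Rightarrow> 'g \<times> 'v \<Rightarrow> 'g \<times> 'v \<Rightarrow> 'g \<times> 'v" where
  "semidirect br \<rho> (x, u) (y, v) = (br x y, \<rho> x v - \<rho> y u)"

definition dual_rep ::
    "('g \<Rightarrow> 'v::real_vector \<Rightarrow> 'v) \<Rightarrow> 'g \<Rightarrow> 'v dual \<Rightarrow> 'v dual" where
  "dual_rep \<rho> x a = Dual (\<lambda>u. - dual_app a (\<rho> x u))"

definition complex_structure :: "('a::real_vector \<Rightarrow> 'a) \<Rightarrow> bool" where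
  "complex_structure J \<longleftrightarrow> linear J \<and> (\<forall>x. J (J x) = - x)"

definition integrable_wrt :: "('a::real_vector \<Rightarrow> 'a \<Rightarrow> 'a) \<Rightarrow> ('a \<Rightarrow> 'a) \<Rightarrow> bool" where
  "integrable_wrt br J \<longleftrightarrow>
     (\<forall>x y. br x y - br (J x) (J y) + J (br x (J y) + br (J x) y) = 0)"

definition totally_real :: "('g::real_vector \<times> 'v::real_vector \<Rightarrow> 'g \<times> 'v) \<Rightarrow> bool" where
  "totally_real J \<longleftrightarrow> J ` (UNIV \<times> {0}) = {0} \<times> UNIV"

text \<open>The last conjunct is \<open>d\<omega> = 0\<close> evaluated on three vectors (up to an overall sign).\<close>

definition symplectic_form ::
    "('a::real_vector \<Rightarrow> 'a \<Rightarrow> 'a) \<Rightarrow> ('a \<Rightarrow> 'a \<Rightarrow> real) \<Rightarrow> bool" where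
  "symplectic_form br \<omega> \<longleftrightarrow> bilinear \<omega> \<and> (\<forall>x. \<omega> x x = 0) \<and>
     (\<forall>x. (\<forall>y. \<omega> x y = 0) \<longrightarrow> x = 0) \<and>
     (\<forall>x y z. \<omega> (br x y) z + \<omega> (br y z) x + \<omega> (br z x) y = 0)"

text \<open>For \<open>x \<in> \<gg>\<close> the vector \<open>J x\<close> lies in \<open>V\<close>, hence the projection \<open>snd\<close>.\<close>

fun omega_J ::
    "('g::real_vector \<times> 'v::real_vector \<Rightarrow> 'g \<times> 'v) \<Rightarrow> 'g \<times> 'v dual \<Rightarrow> 'g \<times> 'v dual \<Rightarrow> real"
  where
  "omega_J J (x, u) (y, v) = dual_app v (snd (J (x, 0))) - dual_app u (snd (J (y, 0)))"


section \<open>Exterior algebras as algebras of alternating forms\<close>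

text \<open>
  Let \<open>L\<close> be a subspace of a vector space over \<open>'k\<close> with scalar multiplication \<open>sc\<close>.
  An element of the exterior algebra of the dual of \<open>L\<close> is a function on lists of vectors,
  whose restriction to lists of length \<open>n\<close> is its component of degree \<open>n\<close>, an alternating
  \<open>n\<close>-linear form on \<open>L\<close>. Forms are set to \<open>0\<close> on lists that leave \<open>L\<close>. For \<open>L\<close>
  of finite dimension the components of large degree vanish, so that no finiteness condition on
  the degrees is needed.
\<close>

definition alt_forms :: "('k::field \<Rightarrow> 'a::ab_group_add \<Rightarrow> 'a) \<Rightarrow> 'a set \<Rightarrow> ('a list \<Rightarrow> 'k) set" where
  "alt_forms sc L = {F.
     (\<forall>xs. \<not> set xs \<subseteq> L \<longrightarrow> F xs = 0) \<and>
     (\<forall>xs. \<not> distinct xs \<longrightarrow> F xs = 0) \<and>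
     (\<forall>xs ys. \<forall>x\<in>L. \<forall>y\<in>L. set xs \<subseteq> L \<longrightarrow> set ys \<subseteq> L \<longrightarrow>
        F (xs @ (x + y) # ys) = F (xs @ x # ys) + F (xs @ y # ys)) \<and>
     (\<forall>xs ys c. \<forall>x\<in>L. set xs \<subseteq> L \<longrightarrow> set ys \<subseteq> L \<longrightarrow>
        F (xs @ sc c x # ys) = c * F (xs @ x # ys))}"

definition alt_forms_deg ::
    "('k::field \<Rightarrow> 'a::ab_group_add \<Rightarrow> 'a) \<Rightarrow> 'a set \<Rightarrow> nat \<Rightarrow> ('a list \<Rightarrow> 'k) set" where
  "alt_forms_deg sc L n = {F \<in> alt_forms sc L. \<forall>xs. length xs \<noteq> n \<longrightarrow> F xs = 0}"

text \<open>
  The wedge product as a sum over shuffles: \<open>S\<close> is the set of positions whose entries are fed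
  to \<open>F\<close>. For 1-forms, \<open>(F \<and> G)(x, y) = F(x) G(y) - F(y) G(x)\<close>.
\<close>

definition shuffle_sign :: "nat \<Rightarrow> nat set \<Rightarrow> 'k::field" where
  "shuffle_sign n S = (- 1) ^ card {(i, j). i \<in> S \<and> j \<in> {..<n} - S \<and> j < i}"

definition wedge :: "('a list \<Rightarrow> 'k::field) \<Rightarrow> ('a list \<Rightarrow> 'k) \<Rightarrow> 'a list \<Rightarrow> 'k" where
  "wedge F G xs = (\<Sum>S\<in>Pow {..<length xs}.
     shuffle_sign (length xs) S * F (nths xs S) * G (nths xs (- S)))"

text \<open>
  A pairing \<open>p\<close> of a space \<open>W\<close> with \<open>L\<close> turns \<open>w \<in> W\<close> into a 1-form on \<open>L\<close>. If the pairing is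
  perfect, this identifies \<open>W\<close> with the dual of \<open>L\<close>, and the exterior algebra of \<open>W\<close>
  with the alternating forms on \<open>L\<close>.
\<close>

definition one_form :: "'a set \<Rightarrow> ('w \<Rightarrow> 'a \<Rightarrow> 'k::zero) \<Rightarrow> 'w \<Rightarrow> 'a list \<Rightarrow> 'k" where
  "one_form L p w xs = (case xs of [x] \<Rightarrow> if x \<in> L then p w x else 0 | _ \<Rightarrow> 0)"

definition linear_op ::
    "('k::field \<Rightarrow> 'a::ab_group_add \<Rightarrow> 'a) \<Rightarrow> 'a set \<Rightarrow>
     (('a list \<Rightarrow> 'k) \<Rightarrow> 'a list \<Rightarrow> 'k) \<Rightarrow> bool" where
  "linear_op sc L T \<longleftrightarrow>
     (\<forall>F\<in>alt_forms sc L. T F \<in> alt_forms sc L) \<and>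
     (\<forall>F\<in>alt_forms sc L. \<forall>G\<in>alt_forms sc L.
        T (\<lambda>xs. F xs + G xs) = (\<lambda>xs. T F xs + T G xs)) \<and>
     (\<forall>c. \<forall>F\<in>alt_forms sc L. T (\<lambda>xs. c * F xs) = (\<lambda>xs. c * T F xs))"

definition is_ce_differential ::
    "('k::field \<Rightarrow> 'a::ab_group_add \<Rightarrow> 'a) \<Rightarrow> 'a set \<Rightarrow> ('a \<Rightarrow> 'a \<Rightarrow> 'a) \<Rightarrow>
     (('a list \<Rightarrow> 'k) \<Rightarrow> 'a list \<Rightarrow> 'k) \<Rightarrow> bool" where
  "is_ce_differential sc L br D \<longleftrightarrow>
     linear_op sc L D \<and>
     (\<forall>p. \<forall>F\<in>alt_forms_deg sc L p. D F \<in> alt_forms_deg sc L (Suc p)) \<and>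
     (\<forall>p. \<forall>F\<in>alt_forms_deg sc L p. \<forall>G\<in>alt_forms sc L.
        D (wedge F G) = (\<lambda>xs. wedge (D F) G xs + (- 1) ^ p * wedge F (D G) xs)) \<and>
     (\<forall>F\<in>alt_forms_deg sc L 1. \<forall>x\<in>L. \<forall>y\<in>L. D F [x, y] = - F [br x y])"

text \<open>
  A graded biderivation of degree \<open>-1\<close> that restricts to the bracket \<open>wbr\<close> on \<open>W\<close>. The
  truncated degree \<open>0 + 0 - 1 = 0\<close> is harmless: the derivation rule forces brackets with
  constants to vanish.
\<close>

definition is_gerstenhaber_bracket ::
    "('k::field \<Rightarrow> 'a::ab_group_add \<Rightarrow> 'a) \<Rightarrow> 'a set \<Rightarrow> 'w set \<Rightarrow> ('w \<Rightarrow> 'a \<Rightarrow> 'k) \<Rightarrow>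
     ('w \<Rightarrow> 'w \<Rightarrow> 'w) \<Rightarrow>
     (('a list \<Rightarrow> 'k) \<Rightarrow> ('a list \<Rightarrow> 'k) \<Rightarrow> 'a list \<Rightarrow> 'k) \<Rightarrow> bool" where
  "is_gerstenhaber_bracket sc L W p wbr B \<longleftrightarrow>
     (\<forall>F\<in>alt_forms sc L. linear_op sc L (B F) \<and> linear_op sc L (\<lambda>G. B G F)) \<and>
     (\<forall>m n. \<forall>F\<in>alt_forms_deg sc L m. \<forall>G\<in>alt_forms_deg sc L n.
        B F G \<in> alt_forms_deg sc L (m + n - 1) \<and>
        B F G = (\<lambda>xs. - ((- 1) ^ ((m + 1) * (n + 1))) * B G F xs)) \<and>
     (\<forall>m n. \<forall>F\<in>alt_forms_deg sc L m. \<forall>G\<in>alt_forms_deg sc L n. \<forall>H\<in>alt_forms sc L.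
        B F (wedge G H) =
          (\<lambda>xs. wedge (B F G) H xs + (- 1) ^ ((m + 1) * n) * wedge G (B F H) xs)) \<and>
     (\<forall>v\<in>W. \<forall>w\<in>W. B (one_form L p v) (one_form L p w) = one_form L p (wbr v w))"


section \<open>Differential Gerstenhaber algebras\<close>

record ('k, 'a) dga =
  dga_carrier :: "'a set"
  dga_deg :: "nat \<Rightarrow> 'a set"
  dga_add :: "'a \<Rightarrow> 'a \<Rightarrow> 'a"
  dga_scale :: "'k \<Rightarrow> 'a \<Rightarrow> 'a"
  dga_wedge :: "'a \<Rightarrow> 'a \<Rightarrow> 'a"
  dga_bracket :: "'a \<Rightarrow> 'a \<Rightarrow> 'a"
  dga_diff :: "'a \<Rightarrow> 'a"

definition dga_isomorphic :: "(complex, 'a) dga \<Rightarrow> (complex, 'b) dga \<Rightarrow> bool" where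
  "dga_isomorphic A B \<longleftrightarrow> (\<exists>f. bij_betw f (dga_carrier A) (dga_carrier B) \<and>
     (\<forall>a\<in>dga_carrier A. \<forall>b\<in>dga_carrier A. f (dga_add A a b) = dga_add B (f a) (f b)) \<and>
     (\<forall>c. \<forall>a\<in>dga_carrier A. f (dga_scale A c a) = dga_scale B c (f a)) \<and>
     (\<forall>n. f ` dga_deg A n \<subseteq> dga_deg B n) \<and>
     (\<forall>a\<in>dga_carrier A. \<forall>b\<in>dga_carrier A. f (dga_wedge A a b) = dga_wedge B (f a) (f b)) \<and>
     (\<forall>a\<in>dga_carrier A. \<forall>b\<in>dga_carrier A. f (dga_bracket A a b) = dga_bracket B (f a) (f b)) \<and>
     (\<forall>a\<in>dga_carrier A. f (dga_diff A a) = dga_diff B (f a)))"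

text \<open>
  The exterior algebra of \<open>W\<close>, realised as the alternating forms on the Lie algebra
  \<open>(L, br)\<close> that \<open>W\<close> is dual to under \<open>p\<close>. When \<open>L\<close> has finite dimension and \<open>p\<close> is perfect,
  the differential and the bracket are uniquely determined on the carrier, so
  neither depends on the choice.
\<close>

definition exterior_dga ::
    "('k::field \<Rightarrow> 'a::ab_group_add \<Rightarrow> 'a) \<Rightarrow> 'a set \<Rightarrow> ('a \<Rightarrow> 'a \<Rightarrow> 'a) \<Rightarrow>
     'w set \<Rightarrow> ('w \<Rightarrow> 'a \<Rightarrow> 'k) \<Rightarrow> ('w \<Rightarrow> 'w \<Rightarrow> 'w) \<Rightarrow> ('k, 'a list \<Rightarrow> 'k) dga" where
  "exterior_dga sc L br W p wbr =
    \<lparr> dga_carrier = alt_forms sc L,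
      dga_deg = alt_forms_deg sc L,
      dga_add = (\<lambda>F G xs. F xs + G xs),
      dga_scale = (\<lambda>c F xs. c * F xs),
      dga_wedge = wedge,
      dga_bracket = (SOME B. is_gerstenhaber_bracket sc L W p wbr B),
      dga_diff = (SOME D. is_ce_differential sc L br D) \<rparr>"

definition complexified_mult ::
    "(real, 'a) dga \<Rightarrow> ('a \<Rightarrow> 'a \<Rightarrow> 'a) \<Rightarrow> 'a cplx \<Rightarrow> 'a cplx \<Rightarrow> 'a cplx" where
  "complexified_mult A f z w = (case (z, w) of ((a, b), (c, d)) \<Rightarrow>
     (dga_add A (f a c) (dga_scale A (- 1) (f b d)), dga_add A (f a d) (f b c)))"

definition complexified_dga :: "(real, 'a) dga \<Rightarrow> (complex, 'a cplx) dga" where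
  "complexified_dga A =
    \<lparr> dga_carrier = dga_carrier A \<times> dga_carrier A,
      dga_deg = (\<lambda>n. dga_deg A n \<times> dga_deg A n),
      dga_add = (\<lambda>(a, b) (c, d). (dga_add A a c, dga_add A b d)),
      dga_scale = (\<lambda>z (a, b).
        (dga_add A (dga_scale A (Re z) a) (dga_scale A (- Im z) b),
         dga_add A (dga_scale A (Re z) b) (dga_scale A (Im z) a))),
      dga_wedge = complexified_mult A (dga_wedge A),
      dga_bracket = complexified_mult A (dga_bracket A),
      dga_diff = (\<lambda>(a, b). (dga_diff A a, dga_diff A b)) \<rparr>"


subsection \<open>The algebra of a complex structure\<close>

type_synonym 'h gen = "'h cplx \<times> 'h dual cplx"

definition gen_scale :: "complex \<Rightarrow> 'h::real_vector gen \<Rightarrow> 'h gen" where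
  "gen_scale c z = (cscale c (fst z), cscale c (snd z))"

definition h10 :: "('h::real_vector \<Rightarrow> 'h) \<Rightarrow> 'h cplx set" where
  "h10 J = {z. map_prod J J z = cscale \<i> z}"

definition h01 :: "('h::real_vector \<Rightarrow> 'h) \<Rightarrow> 'h cplx set" where
  "h01 J = {z. map_prod J J z = cscale (- \<i>) z}"

definition hs10 :: "('h::real_vector \<Rightarrow> 'h) \<Rightarrow> 'h dual cplx set" where
  "hs10 J = {a. \<forall>z\<in>h01 J. ceval a z = 0}"

definition hs01 :: "('h::real_vector \<Rightarrow> 'h) \<Rightarrow> 'h dual cplx set" where
  "hs01 J = {a. \<forall>z\<in>h10 J. ceval a z = 0}"

definition f1 :: "('h::real_vector \<Rightarrow> 'h) \<Rightarrow> 'h gen set" where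
  "f1 J = h10 J \<times> hs01 J"

definition f1bar :: "('h::real_vector \<Rightarrow> 'h) \<Rightarrow> 'h gen set" where
  "f1bar J = h01 J \<times> hs10 J"

text \<open>The contraction \<open>\<iota>\<^sub>x d\<alpha>\<close>, with \<open>d\<alpha>(x, y) = -\<alpha>([x, y])\<close>.\<close>

definition contract_d ::
    "('h::real_vector \<Rightarrow> 'h \<Rightarrow> 'h) \<Rightarrow> 'h \<Rightarrow> 'h dual \<Rightarrow> 'h dual" where
  "contract_d br x \<alpha> = Dual (\<lambda>y. - dual_app \<alpha> (br x y))"

definition schouten :: "('h::real_vector \<Rightarrow> 'h \<Rightarrow> 'h) \<Rightarrow> 'h gen \<Rightarrow> 'h gen \<Rightarrow> 'h gen" where
  "schouten br = (\<lambda>(x, \<alpha>) (y, \<beta>).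
     (cbil br x y, cbil (contract_d br) x \<beta> - cbil (contract_d br) y \<alpha>))"

definition gen_pairing :: "'h::real_vector gen \<Rightarrow> 'h gen \<Rightarrow> complex" where
  "gen_pairing = (\<lambda>(x, \<alpha>) (y, \<beta>). ceval \<alpha> y + ceval \<beta> x)"

definition DGA_complex ::
    "('h::real_vector \<Rightarrow> 'h \<Rightarrow> 'h) \<Rightarrow> ('h \<Rightarrow> 'h) \<Rightarrow> (complex, 'h gen list \<Rightarrow> complex) dga" where
  "DGA_complex br J =
     exterior_dga gen_scale (f1bar J) (schouten br) (f1 J) gen_pairing (schouten br)"


subsection \<open>The algebra of a symplectic form\<close>

definition flat :: "('k::real_vector \<Rightarrow> 'k \<Rightarrow> real) \<Rightarrow> 'k \<Rightarrow> 'k dual" where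
  "flat \<omega> x = Dual (\<omega> x)"

definition omega_bracket ::
    "('k::real_vector \<Rightarrow> 'k \<Rightarrow> 'k) \<Rightarrow> ('k \<Rightarrow> 'k \<Rightarrow> real) \<Rightarrow> 'k dual \<Rightarrow> 'k dual \<Rightarrow> 'k dual" where
  "omega_bracket br \<omega> \<alpha> \<beta> = flat \<omega> (br (inv (flat \<omega>) \<alpha>) (inv (flat \<omega>) \<beta>))"

definition DGA_symplectic ::
    "('k::real_vector \<Rightarrow> 'k \<Rightarrow> 'k) \<Rightarrow> ('k \<Rightarrow> 'k \<Rightarrow> real) \<Rightarrow>
     (complex, ('k list \<Rightarrow> real) cplx) dga" where
  "DGA_symplectic br \<omega> =
     complexified_dga (exterior_dga scaleR UNIV br UNIV dual_app (omega_bracket br \<omega>))"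

section \<open>The constructions preserve the defining conditions\<close>

lemma dual_app_Dual: "linear f \<Longrightarrow> dual_app (Dual f) = f"
  by (simp add: Dual_inverse)

lemma linear_dual_app: "linear (dual_app a)"
  using dual_app by auto

lemma dual_app_add: "dual_app (a + b) x = dual_app a x + dual_app b x"
  by (simp add: plus_dual.rep_eq)
lemma dual_app_diff: "dual_app (a - b) x = dual_app a x - dual_app b x"
  by (simp add: minus_dual.rep_eq)
lemma dual_app_scaleR: "dual_app (c *\<^sub>R a) x = c * dual_app a x"
  by (simp add: scaleR_dual.rep_eq)
lemma dual_app_0: "dual_app 0 x = 0"
  by (simp add: zero_dual.rep_eq)
lemma dual_eqI: "(\<And>x. dual_app a x = dual_app b x) \<Longrightarrow> a = b"
  by (simp add: dual_app_inject[symmetric] fun_eq_iff)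

lemma fin_dim_basis:
  assumes "fin_dim TYPE('a::real_vector)"
  obtains B :: "'a::real_vector set" where "finite B" "independent B" "span B = UNIV"
proof -
  obtain B :: "'a set" where B: "finite B" "span B = UNIV" using assms by (auto simp: fin_dim_def)
  obtain C where "C \<subseteq> B" "independent C" "B \<subseteq> span C"
    using maximal_independent_subset[of B] by blast
  then have "span C = UNIV" using B by (metis span_mono span_span top.extremum_uniqueI)
  then show ?thesis using that[of C] \<open>independent C\<close> \<open>C \<subseteq> B\<close> B finite_subset by blast
qed

lemma fin_dim_prod:
  assumes "fin_dim TYPE('a::real_vector)" "fin_dim TYPE('b::real_vector)"
  shows "fin_dim TYPE('a \<times> 'b)"
proof -
  obtain A :: "'a set" where A: "finite A" "span A = UNIV" using assms by (auto simp: fin_dim_def)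
  obtain B :: "'b set" where B: "finite B" "span B = UNIV" using assms by (auto simp: fin_dim_def)
  let ?C = "(\<lambda>x. (x, 0)) ` A \<union> (\<lambda>y. (0, y)) ` B"
  have l1: "linear (\<lambda>x::'a. (x, 0::'b))" by (intro linearI) auto
  have l2: "linear (\<lambda>y::'b. (0::'a, y))" by (intro linearI) auto
  have s1: "(x, 0) \<in> span ?C" for x
  proof -
    have "(x, 0) \<in> (\<lambda>x. (x, 0)) ` span A" using A by blast
    then have "(x, 0) \<in> span ((\<lambda>x. (x, 0::'b)) ` A)" using linear_span_image[OF l1, of A] by metis
    then show ?thesis using span_mono[OF Un_upper1] by (rule rev_subsetD)
  qed
  have s2: "(0, y) \<in> span ?C" for y
  proof -
    have "(0, y) \<in> (\<lambda>y. (0, y)) ` span B" using B by blast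
    then have "(0, y) \<in> span ((\<lambda>y. (0::'a, y)) ` B)" using linear_span_image[OF l2, of B] by metis
    then show ?thesis using span_mono[OF Un_upper2] by (rule rev_subsetD)
  qed
  have "z \<in> span ?C" for z
  proof -
    have "z = (fst z, 0) + (0, snd z)" by simp
    then show ?thesis using span_add[OF s1 s2, of "fst z" "snd z"] by (simp only:)
  qed
  then have "span ?C = UNIV" by (intro UNIV_eq_I[symmetric])
  moreover have "finite ?C" using A(1) B(1) by (intro finite_UnI finite_imageI)
  ultimately show ?thesis unfolding fin_dim_def by (intro exI[of _ ?C] conjI)
qed

lemma fin_dim_dual:
  assumes "fin_dim TYPE('a::real_vector)"
  shows "fin_dim TYPE('a dual)"
proof -
  obtain B :: "'a set" where B: "finite B" "independent B" "span B = UNIV"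
    using fin_dim_basis[OF assms] .
  define e where "e b = Dual (\<lambda>x. real_vector.representation B x b)" for b
  have e: "dual_app (e b) x = real_vector.representation B x b" for b x
  proof -
    have "linear (\<lambda>x. real_vector.representation B x b)"
      using B by (intro linearI) (auto simp: real_vector.representation_add real_vector.representation_scale)
    then show ?thesis by (simp add: e_def dual_app_Dual)
  qed
  have "a \<in> span (e ` B)" for a
  proof -
    have "a = (\<Sum>b\<in>B. dual_app a b *\<^sub>R e b)"
    proof (rule dual_eqI)
      fix x
      have s: "dual_app (\<Sum>b\<in>B. dual_app a b *\<^sub>R e b) x = (\<Sum>b\<in>B. dual_app a b * dual_app (e b) x)"
        by (induction B rule: infinite_finite_induct) (auto simp: dual_app_add dual_app_scaleR dual_app_0)
      have "x = (\<Sum>b\<in>B. real_vector.representation B x b *\<^sub>R b)"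
        using real_vector.sum_representation_eq[of B x B] B by auto
      then have "dual_app a x = dual_app a (\<Sum>b\<in>B. real_vector.representation B x b *\<^sub>R b)" by simp
      also have "\<dots> = (\<Sum>b\<in>B. real_vector.representation B x b * dual_app a b)"
        by (simp add: linear_sum[OF linear_dual_app] linear_scale[OF linear_dual_app])
      finally show "dual_app a x = dual_app (\<Sum>b\<in>B. dual_app a b *\<^sub>R e b) x"
        unfolding s e by (simp add: mult.commute)
    qed
    also have "\<dots> \<in> span (e ` B)" by (intro span_sum span_scale span_base) auto
    finally show ?thesis .
  qed
  then have "span (e ` B) = UNIV" by (intro UNIV_eq_I[symmetric])
  then show ?thesis unfolding fin_dim_def using B(1) by (intro exI[of _ "e ` B"] conjI finite_imageI)
qed

lemma bilinearI:
  assumes "\<And>x y z. f (x + y) z = f x z + f y z" "\<And>x y z. f x (y + z) = f x y + f x z"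
    "\<And>c x y. f (c *\<^sub>R x) y = c *\<^sub>R f x y" "\<And>c x y. f x (c *\<^sub>R y) = c *\<^sub>R f x y"
  shows "bilinear f"
  unfolding bilinear_def using assms by (auto intro!: linearI)

lemma lie_algebra_semidirect:
  assumes "lie_algebra br" "lie_representation br \<rho>"
  shows "lie_algebra (semidirect br \<rho>)"
proof -
  have b: "bilinear br" "bilinear \<rho>" and r: "\<And>x y v. \<rho> (br x y) v = \<rho> x (\<rho> y v) - \<rho> y (\<rho> x v)"
    and j: "\<And>x y z. br x (br y z) + br y (br z x) + br z (br x y) = 0" and z: "\<And>x. br x x = 0"
    using assms by (auto simp: lie_algebra_def lie_representation_def)
  note s = bilinear_ladd[OF b(1)] bilinear_radd[OF b(1)] bilinear_lmul[OF b(1)] bilinear_rmul[OF b(1)]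
    bilinear_ladd[OF b(2)] bilinear_radd[OF b(2)] bilinear_lmul[OF b(2)] bilinear_rmul[OF b(2)]
    bilinear_rsub[OF b(2)] bilinear_lsub[OF b(2)]
  have "bilinear (semidirect br \<rho>)"
    by (rule bilinearI) (auto simp: s algebra_simps)
  moreover have "semidirect br \<rho> a a = 0" for a by (cases a) (auto simp: z zero_prod_def)
  moreover have "semidirect br \<rho> a (semidirect br \<rho> b c) + semidirect br \<rho> b (semidirect br \<rho> c a)
     + semidirect br \<rho> c (semidirect br \<rho> a b) = 0" for a b c
    by (cases a; cases b; cases c) (simp add: s r j zero_prod_def)
  ultimately show ?thesis
    using fin_dim_prod assms unfolding lie_algebra_def lie_representation_def by blast
qed

lemma lie_representation_dual_rep:
  assumes "lie_algebra br" "lie_representation br \<rho>"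
  shows "lie_representation br (dual_rep \<rho>)"
proof -
  have b: "bilinear \<rho>" and r: "\<And>x y v. \<rho> (br x y) v = \<rho> x (\<rho> y v) - \<rho> y (\<rho> x v)"
    using assms by (auto simp: lie_representation_def)
  note s = bilinear_ladd[OF b] bilinear_radd[OF b] bilinear_lmul[OF b] bilinear_rmul[OF b]
  have app: "dual_app (dual_rep \<rho> x a) u = - dual_app a (\<rho> x u)" for x a u
  proof -
    have "linear (\<lambda>u. - dual_app a (\<rho> x u))"
      by (intro linearI) (auto simp: s linear_add[OF linear_dual_app] linear_scale[OF linear_dual_app])
    then show ?thesis by (simp add: dual_rep_def dual_app_Dual)
  qed
  note t = app dual_app_add dual_app_diff dual_app_scaleR s r
    linear_add[OF linear_dual_app] linear_scale[OF linear_dual_app] linear_diff[OF linear_dual_app]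
  have "bilinear (dual_rep \<rho>)"
    by (rule bilinearI; rule dual_eqI) (auto simp: t algebra_simps)
  moreover have "dual_rep \<rho> (br x y) v = dual_rep \<rho> x (dual_rep \<rho> y v) - dual_rep \<rho> y (dual_rep \<rho> x v)" for x y v
    by (rule dual_eqI) (auto simp: t)
  ultimately show ?thesis using assms fin_dim_dual unfolding lie_representation_def by blast
qed

lemma symplectic_form_omega_J:
  assumes "lie_algebra br" "lie_representation br \<rho>" "complex_structure J"
    "integrable_wrt (semidirect br \<rho>) J" "totally_real J"
  shows "symplectic_form (semidirect br (dual_rep \<rho>)) (omega_J J)"
proof -
  have b: "bilinear \<rho>" "bilinear br" using assms by (auto simp: lie_representation_def lie_algebra_def)
  have app: "dual_app (dual_rep \<rho> x a) u = - dual_app a (\<rho> x u)" for x a u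
  proof -
    have "linear (\<lambda>u. - dual_app a (\<rho> x u))"
      by (intro linearI) (auto simp: bilinear_radd[OF b(1)] bilinear_rmul[OF b(1)] linear_add[OF linear_dual_app] linear_scale[OF linear_dual_app])
    then show ?thesis by (simp add: dual_rep_def dual_app_Dual)
  qed
  define j where "j x = snd (J (x, 0))" for x
  have lJ: "linear J" using assms by (simp add: complex_structure_def)
  have lj: "linear j" unfolding j_def
    using linear_compose[OF linear_compose[OF _ lJ] linear_snd, of "\<lambda>x. (x, 0)"]
    by (simp add: o_def) (metis (no_types, lifting) add.right_neutral add_Pair linearI scaleR_Pair scaleR_zero_right)
  have Jj: "J (x, 0) = (0, j x)" for x
  proof -
    have "J (x, 0) \<in> {0} \<times> UNIV" using assms(5) unfolding totally_real_def by blast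
    then show ?thesis unfolding j_def by auto
  qed
  have J2: "J (J z) = - z" for z using assms(3) unfolding complex_structure_def by blast
  have surj: "\<exists>x. v = j x" for v
  proof -
    have "(0, v) \<in> J ` (UNIV \<times> {0})" using assms(5) unfolding totally_real_def by simp
    then show ?thesis using Jj by auto
  qed
  have inj: "x = 0" if "j x = 0" for x
    using J2[of "(x, 0)"] that linear_0[OF lJ] by (simp add: Jj zero_prod_def)
  have om: "omega_J J (x, u) (y, v) = dual_app v (j x) - dual_app u (j y)" for x u y v
    by (simp add: j_def)
  note l = linear_add[OF linear_dual_app] linear_scale[OF linear_dual_app] linear_diff[OF linear_dual_app]
    linear_0[OF linear_dual_app] linear_add[OF lj] linear_scale[OF lj] linear_0[OF lj] linear_neg[OF linear_dual_app]
  have z0: "\<rho> x 0 = 0" "br x 0 = 0" "\<rho> 0 v = 0" "br 0 x = 0" for x v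
    using b by (auto simp: bilinear_rzero bilinear_lzero)
  have key: "j (br x y) = \<rho> x (j y) - \<rho> y (j x)" for x y
  proof -
    have "semidirect br \<rho> (x, 0) (y, 0) - semidirect br \<rho> (J (x, 0)) (J (y, 0))
      + J (semidirect br \<rho> (x, 0) (J (y, 0)) + semidirect br \<rho> (J (x, 0)) (y, 0)) = 0"
      using assms(4) unfolding integrable_wrt_def by blast
    then have "(br x y, 0) + J (0, \<rho> x (j y) - \<rho> y (j x)) = 0" by (simp add: Jj z0)
    then have "J (br x y, 0) + J (J (0, \<rho> x (j y) - \<rho> y (j x))) = 0"
      by (metis lJ linear_add linear_0)
    then have "j (br x y) + (\<rho> y (j x) - \<rho> x (j y)) = 0" by (simp add: J2 Jj zero_prod_def)
    then show ?thesis by (simp add: eq_neg_iff_add_eq_0[symmetric])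
  qed
  have "bilinear (omega_J J)"
    by (rule bilinearI) (auto simp: om l dual_app_add dual_app_scaleR algebra_simps split: prod.splits simp del: omega_J.simps)
  moreover have "omega_J J x x = 0" for x by (cases x) simp
  moreover have "x = 0" if "\<forall>y. omega_J J x y = 0" for x
  proof (cases x)
    case (Pair y u)
    have "dual_app u v = 0" for v
    proof -
      obtain w where "v = j w" using surj by blast
      then show ?thesis using that[rule_format, of "(w, 0)"] by (simp add: om dual_app_0 Pair del: omega_J.simps)
    qed
    then have u: "u = 0" by (intro dual_eqI) (simp add: dual_app_0)
    have "dual_app v (j y) = 0" for v
      using that[rule_format, of "(0, v)"] by (simp add: om l Pair del: omega_J.simps)
    then have *: "f (j y) = 0" if "linear f" for f :: "'b \<Rightarrow> real"
      using dual_app_Dual[OF that] by metis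
    have "j y = 0"
    proof (rule ccontr)
      assume "j y \<noteq> 0"
      then have "independent {j y}" by simp
      then obtain f :: "'b \<Rightarrow> real" where "linear f" "f (j y) = 1"
        using linear_independent_extend[of "{j y}" "\<lambda>_. 1"] by auto
      then show False using *[OF \<open>linear f\<close>] by simp
    qed
    then show ?thesis using inj Pair u by (simp add: zero_prod_def)
  qed
  moreover have "omega_J J (semidirect br (dual_rep \<rho>) x y) z + omega_J J (semidirect br (dual_rep \<rho>) y z) x
     + omega_J J (semidirect br (dual_rep \<rho>) z x) y = 0" for x y z
    by (cases x; cases y; cases z) (simp add: om key l app dual_app_diff del: omega_J.simps)
  ultimately show ?thesis unfolding symplectic_form_def by blast
qed

end

theory Submission
  imports Defs
begin

text \<open>
  Contraction with a vector is an odd derivation of the exterior algebra, and for a form \<open>F\<close> of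
  degree \<open>p\<close> on a space with basis \<open>e\<^sub>i\<close> and dual basis \<open>e\<^sup>i\<close> one has Euler's identity
  \<open>p F = (\<Sum>i. e\<^sup>i \<and> \<iota>\<^sub>i F)\<close>. Hence a derivation is determined by its values on 1-forms, the
  Chevalley-Eilenberg differential must be \<open>F \<mapsto> (\<Sum>i. de\<^sup>i \<and> \<iota>\<^sub>i F)\<close>, and the Gerstenhaber bracket must
  be \<open>(F, G) \<mapsto> \<plusminus> (\<Sum>i j. \<iota>\<^sub>i F \<and> [e\<^sup>i, e\<^sup>j] \<and> \<iota>\<^sub>j G)\<close>; conversely these formulas have the required properties.

  Write \<open>j\<close> for the isomorphism of \<open>\<gg>\<close> with \<open>V\<close> given by \<open>J\<close>; integrability says
  \<open>j [x, y] = \<rho>(x) (j y) - \<rho>(y) (j x)\<close>. Extending \<open>u \<in> V\<^sup>*\<close> by \<open>0\<close> on \<open>\<gg>\<close>, the real linear map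
  \<open>\<psi>\<^sub>J (x + u) = (x + i J x) + (i/2) (u - i u \<circ> J)\<close> is a homomorphism from the dual semi-direct product
  to the complex Lie algebra \<open>f1bar J\<close> that induces an isomorphism on the complexification. Likewise \<open>\<psi>\<^bsub>-J\<^esub>\<close>
  maps into \<open>f1 J = f1bar (-J)\<close>, and \<open>\<langle>\<psi>\<^bsub>-J\<^esub>(k), \<psi>\<^sub>J(l)\<rangle> = \<omega>\<^sub>J(k, l)\<close>: under the
  pairing, \<open>\<psi>\<^bsub>-J\<^esub>\<close> becomes the map \<open>\<omega>\<^sub>J\<close> used to define the bracket on the symplectic side. Pulling back forms along \<open>\<psi>\<^sub>J\<close> is the isomorphism.
\<close>

section \<open>The shuffle product\<close>

text \<open>\<open>contr\<close>, \<open>sgnop\<close> and \<open>homog\<close> act on arbitrary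
  functions on lists, so the algebra of \<open>wedge\<close> is developed before alternation or
  linearity enters.\<close>

definition contr :: "'a \<Rightarrow> ('a list \<Rightarrow> 'k) \<Rightarrow> 'a list \<Rightarrow> 'k" where
  "contr x F = (\<lambda>xs. F (x # xs))"

text \<open>The grading involution. Giving each component its own sign lets sign rules be stated for
  inhomogeneous forms.\<close>

definition sgnop :: "('a list \<Rightarrow> 'k::field) \<Rightarrow> 'a list \<Rightarrow> 'k" where
  "sgnop F = (\<lambda>xs. (- 1) ^ length xs * F xs)"

definition homog :: "nat \<Rightarrow> ('a list \<Rightarrow> 'k::zero) \<Rightarrow> bool" where
  "homog p F \<longleftrightarrow> (\<forall>xs. length xs \<noteq> p \<longrightarrow> F xs = 0)"

section \<open>Recursion for the shuffle product\<close>

text \<open>Sets of positions in a list \<open>x # xs\<close> are split by whether position 0, that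
  of \<open>x\<close>, is selected; this is the source of the two summands in
  \<open>wedge_Cons\<close>.\<close>

lemma Pow_lessThan_Suc:
  "Pow {..<Suc n} = (\<lambda>S. Suc ` S) ` Pow {..<n} \<union> (\<lambda>S. insert 0 (Suc ` S)) ` Pow {..<n}"
proof -
  have "S \<in> (\<lambda>S. Suc ` S) ` Pow {..<n} \<union> (\<lambda>S. insert 0 (Suc ` S)) ` Pow {..<n}"
    if "S \<subseteq> {..<Suc n}" for S
  proof -
    let ?T = "{i. Suc i \<in> S}"
    have T: "?T \<in> Pow {..<n}" using that by auto
    have "S = (if 0 \<in> S then insert 0 (Suc ` ?T) else Suc ` ?T)"
    proof (rule set_eqI)
      fix i show "i \<in> S \<longleftrightarrow> i \<in> (if 0 \<in> S then insert 0 (Suc ` ?T) else Suc ` ?T)"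
        by (cases i) auto
    qed
    then show ?thesis using T by (auto split: if_splits)
  qed
  then show ?thesis by auto
qed

text \<open>The sign counts inversions. If position 0 goes to the second factor, every selected
  position jumps over it, which adds \<open>card S\<close> inversions; if it is itself selected, it
  comes first and adds none.\<close>

lemma shuffle_sign_Suc_image:
  assumes "S \<subseteq> {..<n}"
  shows "shuffle_sign (Suc n) (Suc ` S) = (- 1) ^ card S * shuffle_sign n S"
    and "shuffle_sign (Suc n) (insert 0 (Suc ` S)) = shuffle_sign n S"
proof -
  let ?P = "{(i, j). i \<in> S \<and> j \<in> {..<n} - S \<and> j < i}"
  have fS: "finite S" using assms finite_subset by blast
  have fP: "finite ?P" by (rule finite_subset[of _ "S \<times> {..<n}"]) (use fS in auto)
  let ?g = "\<lambda>(i, j). (Suc i, Suc j)"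
  have g: "inj_on ?g A" for A by (auto simp: inj_on_def)
  have "{(i, j). i \<in> Suc ` S \<and> j \<in> {..<Suc n} - Suc ` S \<and> j < i}
      = (\<lambda>i. (Suc i, 0)) ` S \<union> ?g ` ?P" (is "?A = ?B \<union> ?C")
  proof (rule set_eqI)
    fix q show "q \<in> ?A \<longleftrightarrow> q \<in> ?B \<union> ?C"
    proof (cases q)
      case (Pair i j)
      then show ?thesis by (cases i; cases j) (auto simp: image_iff)
    qed
  qed
  moreover have "card (?B \<union> ?C) = card ?B + card ?C"
    by (rule card_Un_disjoint) (use fS fP in auto)
  moreover have "card ?B = card S" by (rule card_image) (auto simp: inj_on_def)
  moreover have "card ?C = card ?P" using g by (rule card_image)
  ultimately show "shuffle_sign (Suc n) (Suc ` S) = (- 1) ^ card S * shuffle_sign n S"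
    by (simp add: shuffle_sign_def power_add)
  have "{(i, j). i \<in> insert 0 (Suc ` S) \<and> j \<in> {..<Suc n} - insert 0 (Suc ` S) \<and> j < i} = ?C" (is "?A = _")
  proof (rule set_eqI)
    fix q show "q \<in> ?A \<longleftrightarrow> q \<in> ?C"
    proof (cases q)
      case (Pair i j)
      then show ?thesis by (cases i; cases j) (auto simp: image_iff)
    qed
  qed
  then show "shuffle_sign (Suc n) (insert 0 (Suc ` S)) = shuffle_sign n S"
    using \<open>card ?C = card ?P\<close> by (simp add: shuffle_sign_def)
qed

lemma wedge_Nil: "wedge F G [] = F [] * G []"
  by (simp add: wedge_def shuffle_sign_def)

text \<open>
  Contraction is an odd derivation. Being a recursion on lists, this reduces the algebra of \<open>wedge\<close>
  to list inductions.
\<close>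

lemma wedge_Cons:
  "wedge F G (x # xs) = wedge (contr x F) G xs + wedge (sgnop F) (contr x G) xs"
proof -
  let ?n = "length xs"
  let ?t = "\<lambda>S. shuffle_sign (Suc ?n) S * F (nths (x # xs) S) * G (nths (x # xs) (- S))"
  \<comment> \<open>Both maps are undone by the preimage under \<open>Suc\<close>.\<close>
  have inj: "inj_on (\<lambda>S. Suc ` S) (Pow {..<?n})" "inj_on (\<lambda>S. insert 0 (Suc ` S)) (Pow {..<?n})"
    by (auto simp: inj_on_def dest: arg_cong[where f = "\<lambda>S. Suc -` S"] simp: inj_vimage_image_eq)
  have "wedge F G (x # xs) = (\<Sum>S\<in>Pow {..<Suc ?n}. ?t S)" by (simp add: wedge_def)
  also have "\<dots> = (\<Sum>S\<in>(\<lambda>S. Suc ` S) ` Pow {..<?n}. ?t S) + (\<Sum>S\<in>(\<lambda>S. insert 0 (Suc ` S)) ` Pow {..<?n}. ?t S)"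
    unfolding Pow_lessThan_Suc by (rule sum.union_disjoint) auto
  also have "\<dots> = (\<Sum>S\<in>Pow {..<?n}. ?t (Suc ` S)) + (\<Sum>S\<in>Pow {..<?n}. ?t (insert 0 (Suc ` S)))"
    by (simp add: sum.reindex[OF inj(1)] sum.reindex[OF inj(2)])
  also have "(\<Sum>S\<in>Pow {..<?n}. ?t (Suc ` S)) = wedge (sgnop F) (contr x G) xs"
    unfolding wedge_def
  proof (rule sum.cong[OF refl])
    fix S assume "S \<in> Pow {..<?n}"
    then have S: "S \<subseteq> {..<?n}" by simp
    \<comment> \<open>The cardinality of this set is the length of \<open>nths xs S\<close>, so the
      factor \<open>(- 1) ^ card S\<close> is the sign supplied by \<open>sgnop F\<close>.\<close>
    have "{i. i < ?n \<and> i \<in> S} = S" using S by auto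
    moreover have "{j. Suc j \<in> Suc ` S} = S" "{j. Suc j \<in> - (Suc ` S)} = - S" by auto
    ultimately show "?t (Suc ` S) = shuffle_sign ?n S * sgnop F (nths xs S) * contr x G (nths xs (- S))"
      by (simp add: nths_Cons shuffle_sign_Suc_image[OF S] sgnop_def contr_def length_nths)
  qed
  also have "(\<Sum>S\<in>Pow {..<?n}. ?t (insert 0 (Suc ` S))) = wedge (contr x F) G xs"
    unfolding wedge_def
  proof (rule sum.cong[OF refl])
    fix S assume "S \<in> Pow {..<?n}"
    then have S: "S \<subseteq> {..<?n}" by simp
    have "{j. Suc j \<in> insert 0 (Suc ` S)} = S" "{j. Suc j \<in> - insert 0 (Suc ` S)} = - S" by auto
    then show "?t (insert 0 (Suc ` S)) = shuffle_sign ?n S * contr x F (nths xs S) * G (nths xs (- S))"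
      by (simp add: nths_Cons shuffle_sign_Suc_image[OF S] contr_def)
  qed
  finally show ?thesis by simp
qed

section \<open>Bilinearity of the wedge product\<close>

lemma wedge_add_left: "wedge (\<lambda>xs. F xs + G xs) H = (\<lambda>xs. wedge F H xs + wedge G H xs)"
  by (rule ext) (simp add: wedge_def algebra_simps sum.distrib)
lemma wedge_add_right: "wedge H (\<lambda>xs. F xs + G xs) = (\<lambda>xs. wedge H F xs + wedge H G xs)"
  by (rule ext) (simp add: wedge_def algebra_simps sum.distrib)
lemma wedge_scale_left: "wedge (\<lambda>xs. k * F xs) H = (\<lambda>xs. k * wedge F H xs)"
  by (rule ext) (simp add: wedge_def algebra_simps sum_distrib_left)
lemma wedge_scale_right: "wedge H (\<lambda>xs. k * F xs) = (\<lambda>xs. k * wedge H F xs)"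
  by (rule ext) (simp add: wedge_def algebra_simps sum_distrib_left)
lemma wedge_minus_left: "wedge (\<lambda>xs. - F xs) H = (\<lambda>xs. - wedge F H xs)"
  using wedge_scale_left[of "- 1" F H] by simp
lemma wedge_minus_right: "wedge H (\<lambda>xs. - F xs) = (\<lambda>xs. - wedge H F xs)"
  using wedge_scale_right[of H "- 1" F] by simp
lemma wedge_0_left [simp]: "wedge (\<lambda>_. 0) H = (\<lambda>_. 0)"
  by (rule ext) (simp add: wedge_def)
lemma wedge_0_right [simp]: "wedge H (\<lambda>_. 0) = (\<lambda>_. 0)"
  by (rule ext) (simp add: wedge_def)
lemma wedge_sum_left: "wedge (\<lambda>xs. \<Sum>i\<in>I. F i xs) H = (\<lambda>xs. \<Sum>i\<in>I. wedge (F i) H xs)"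
  by (induction I rule: infinite_finite_induct) (simp_all add: wedge_add_left)
lemma wedge_sum_right: "wedge H (\<lambda>xs. \<Sum>i\<in>I. F i xs) = (\<lambda>xs. \<Sum>i\<in>I. wedge H (F i) xs)"
  by (induction I rule: infinite_finite_induct) (simp_all add: wedge_add_right)

section \<open>Grading involution and associativity\<close>

lemma contr_wedge: "contr x (wedge F G) = (\<lambda>xs. wedge (contr x F) G xs + wedge (sgnop F) (contr x G) xs)"
  by (rule ext) (simp add: contr_def[of x "wedge F G"] wedge_Cons)

lemma contr_sgnop: "contr x (sgnop F) = (\<lambda>xs. - sgnop (contr x F) xs)"
  by (rule ext) (simp add: contr_def sgnop_def)

lemma sgnop_sgnop [simp]: "sgnop (sgnop F) = F"
  by (rule ext) (simp add: sgnop_def mult.assoc[symmetric] power_add[symmetric])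

text \<open>The grading involution anticommutes with contraction, so both sides satisfy the same
  recursion on lists.\<close>

lemma sgnop_wedge: "sgnop (wedge F G) = wedge (sgnop F) (sgnop G)"
proof (rule ext)
  fix xs show "sgnop (wedge F G) xs = wedge (sgnop F) (sgnop G) xs"
  proof (induction xs arbitrary: F G)
    case Nil
    then show ?case by (simp add: wedge_Nil sgnop_def)
  next
    case (Cons x xs)
    have "sgnop (wedge F G) (x # xs) = - sgnop (wedge (contr x F) G) xs - sgnop (wedge (sgnop F) (contr x G)) xs"
      by (simp add: sgnop_def wedge_Cons algebra_simps)
    also have "\<dots> = wedge (sgnop F) (sgnop G) (x # xs)"
      by (simp add: Cons.IH wedge_Cons contr_sgnop wedge_minus_left wedge_minus_right)
    finally show ?case .
  qed
qed

text \<open>Both sides unfold to the same three contractions, one for each factor;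
  \<open>sgnop_wedge\<close> splits the sign in front of the contraction of
  \<open>H\<close>.\<close>

lemma wedge_assoc: "wedge (wedge F G) H = wedge F (wedge G H)"
proof (rule ext)
  fix xs show "wedge (wedge F G) H xs = wedge F (wedge G H) xs"
  proof (induction xs arbitrary: F G H)
    case Nil
    then show ?case by (simp add: wedge_Nil)
  next
    case (Cons x xs)
    show ?case
      by (simp add: wedge_Cons contr_wedge wedge_add_left wedge_add_right Cons.IH sgnop_wedge)
  qed
qed

section \<open>Homogeneous forms and graded commutativity\<close>

lemma homog_contr: "homog (Suc p) F \<Longrightarrow> homog p (contr x F)"
  by (simp add: homog_def contr_def)

lemma homog_0_contr: "homog 0 F \<Longrightarrow> contr x F = (\<lambda>_. 0)"
  by (simp add: homog_def contr_def)

lemma sgnop_homog: "homog p F \<Longrightarrow> sgnop F = (\<lambda>xs. (- 1) ^ p * F xs)"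
  unfolding sgnop_def homog_def by (rule ext) (metis mult_zero_right)

lemma homog_sgnop: "homog p F \<Longrightarrow> homog p (sgnop F)"
  by (simp add: sgnop_def homog_def)

lemma homog_0 [simp]: "homog p (\<lambda>_. 0)"
  by (simp add: homog_def)

lemma homog_sum: "(\<And>i. i \<in> I \<Longrightarrow> homog p (F i)) \<Longrightarrow> homog p (\<lambda>xs. \<Sum>i\<in>I. (F i xs :: 'k::field))"
  by (simp add: homog_def)

lemma homog_wedge:
  assumes "homog m F" "homog n G"
  shows "homog (m + n) (wedge F G)"
proof -
  have "wedge F G xs = 0" if "length xs \<noteq> m + n" for xs
    using assms that
  proof (induction xs arbitrary: F G m n)
    case Nil
    then show ?case by (auto simp: wedge_Nil homog_def)
  next
    case (Cons x xs)
    have "wedge (contr x F) G xs = 0"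
    proof (cases m)
      case 0 then show ?thesis using Cons.prems by (simp add: homog_0_contr)
    next
      case (Suc k) then show ?thesis
        using Cons.prems by (intro Cons.IH[of k _ n]) (auto simp: homog_contr)
    qed
    moreover have "wedge (sgnop F) (contr x G) xs = 0"
    proof (cases n)
      case 0 then show ?thesis using Cons.prems by (simp add: homog_0_contr)
    next
      case (Suc k) then show ?thesis
        using Cons.prems by (intro Cons.IH[of m _ k]) (auto simp: homog_contr homog_sgnop)
    qed
    ultimately show ?case by (simp add: wedge_Cons)
  qed
  then show ?thesis by (simp add: homog_def)
qed

text \<open>The \<open>m\<close>-fold \<open>sgnop\<close> puts the usual sign
  \<open>(- 1) ^ (m * n)\<close> on the component of \<open>G\<close> of degree \<open>n\<close>, so
  that \<open>G\<close> may be inhomogeneous.\<close>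

lemma wedge_commute_homog:
  assumes "homog m F"
  shows "wedge F G = wedge ((sgnop ^^ m) G) F"
proof (rule ext)
  \<comment> \<open>Each copy of \<open>sgnop\<close> contributes one sign when \<open>contr\<close>
    passes it; the total \<open>(- 1) ^ m\<close> later matches \<open>sgnop F\<close> for
    \<open>F\<close> of degree \<open>m\<close>.\<close>
  have c: "contr x ((sgnop ^^ m) G) = (\<lambda>xs. (- 1) ^ m * (sgnop ^^ m) (contr x G) xs)" for x m and G :: "'a list \<Rightarrow> 'b"
  proof (induction m)
    case 0
    then show ?case by simp
  next
    case (Suc m)
    have "sgnop (\<lambda>xs. (- 1) ^ m * F xs) = (\<lambda>xs. (- 1) ^ m * sgnop F xs)" for F :: "'a list \<Rightarrow> 'b"
      by (rule ext) (simp add: sgnop_def)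
    then show ?case by (simp add: contr_sgnop Suc)
  qed
  have e: "((sgnop ^^ m) G) [] = G []" for m and G :: "'a list \<Rightarrow> 'b"
    by (induction m) (simp_all add: sgnop_def)
  fix xs show "wedge F G xs = wedge ((sgnop ^^ m) G) F xs"
    using assms
  proof (induction xs arbitrary: F G m)
    case Nil
    then show ?case by (simp add: wedge_Nil e)
  next
    case (Cons x xs)
    have "wedge (contr x F) G xs = wedge (sgnop ((sgnop ^^ m) G)) (contr x F) xs"
    proof (cases m)
      case 0 then show ?thesis using Cons.prems by (simp add: homog_0_contr)
    next
      case (Suc k) then show ?thesis
        using Cons.prems by (simp add: Cons.IH[of k] homog_contr)
    qed
    moreover have "wedge (sgnop F) (contr x G) xs = wedge (contr x ((sgnop ^^ m) G)) F xs"
      by (simp add: sgnop_homog[OF Cons.prems] c wedge_scale_left Cons.IH[OF Cons.prems])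
    ultimately show ?case by (simp add: wedge_Cons)
  qed
qed

lemma funpow_sgnop_homog: "homog n G \<Longrightarrow> (sgnop ^^ m) G = (\<lambda>xs. (- 1) ^ (m * n) * G xs)"
proof (induction m)
  case (Suc m)
  have "sgnop (\<lambda>xs. (- 1) ^ (m * n) * G xs) = (\<lambda>xs. (- 1) ^ (m * n) * sgnop G xs)"
    by (rule ext) (simp add: sgnop_def)
  moreover have "(sgnop ^^ Suc m) G = sgnop (\<lambda>xs. (- 1) ^ (m * n) * G xs)"
    using Suc by simp
  ultimately show ?case using Suc.prems by (simp add: sgnop_homog power_add mult.assoc mult.left_commute)
qed simp

lemma wedge_commute:
  assumes "homog m F" "homog n G"
  shows "wedge F G = (\<lambda>xs. (- 1) ^ (m * n) * wedge G F xs)"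
  by (simp add: wedge_commute_homog[OF assms(1)] funpow_sgnop_homog[OF assms(2)] wedge_scale_left)

lemma sgnop_add: "sgnop (\<lambda>xs. F xs + G xs) = (\<lambda>xs. sgnop F xs + sgnop G xs)"
  by (rule ext) (simp add: sgnop_def algebra_simps)

lemma sgnop_scale: "sgnop (\<lambda>xs. k * F xs) = (\<lambda>xs. k * sgnop F xs)"
  by (rule ext) (simp add: sgnop_def)

lemma contr_add: "contr x (\<lambda>xs. F xs + G xs) = (\<lambda>xs. contr x F xs + contr x G xs)"
  by (simp add: contr_def)

lemma contr_scale: "contr x (\<lambda>xs. k * F xs) = (\<lambda>xs. k * contr x F xs)"
  by (simp add: contr_def)

lemma minus_one_power_eq_of_parity: "even m = even n \<Longrightarrow> (- 1 :: 'k::ring_1) ^ m = (- 1) ^ n"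
  by (cases "even m") simp_all

lemma wedge_two: "wedge F G [x, y] = F [x, y] * G [] + F [x] * G [y] - F [y] * G [x] + F [] * G [x, y]"
  by (simp add: wedge_Cons wedge_Nil contr_def sgnop_def)

lemma wedge_one: "wedge F G [x] = F [x] * G [] + F [] * G [x]"
  by (simp add: wedge_Cons wedge_Nil contr_def sgnop_def)

section \<open>Alternating forms\<close>

text \<open>One setting for the real algebra on a whole type and for the complex algebra on a subset
  of a type whose scalar multiplication is a separate constant. Only closure of \<open>L\<close> is
  recorded, since the forms themselves turn \<open>+\<close> and \<open>sc\<close> into field
  operations. Characteristic 0 allows division by the degree.\<close>

locale scaled_carrier =
  fixes sc :: "'k::field_char_0 \<Rightarrow> 'a::ab_group_add \<Rightarrow> 'a" and L :: "'a set"
  assumes zero_mem: "0 \<in> L"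
    and add_mem: "x \<in> L \<Longrightarrow> y \<in> L \<Longrightarrow> x + y \<in> L"
    and scale_mem: "x \<in> L \<Longrightarrow> sc k x \<in> L"
begin

abbreviation "Alt \<equiv> alt_forms sc L"

lemma alt_outside: "F \<in> Alt \<Longrightarrow> \<not> set xs \<subseteq> L \<Longrightarrow> F xs = 0"
  by (simp add: alt_forms_def)

lemma alt_nondistinct: "F \<in> Alt \<Longrightarrow> \<not> distinct xs \<Longrightarrow> F xs = 0"
  by (simp add: alt_forms_def)

text \<open>The conditions on \<open>xs\<close> and \<open>ys\<close> from the definition drop out,
  because a form vanishes on lists that leave \<open>L\<close>.\<close>

lemma alt_add_arg:
  assumes "F \<in> Alt" "x \<in> L" "y \<in> L"
  shows "F (xs @ (x + y) # ys) = F (xs @ x # ys) + F (xs @ y # ys)"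
proof (cases "set xs \<subseteq> L \<and> set ys \<subseteq> L")
  case True
  then show ?thesis using assms by (simp add: alt_forms_def)
next
  case False
  then show ?thesis using assms by (subst (1 2 3) alt_outside) auto
qed

lemma alt_scale_arg:
  assumes "F \<in> Alt" "x \<in> L"
  shows "F (xs @ sc k x # ys) = k * F (xs @ x # ys)"
proof (cases "set xs \<subseteq> L \<and> set ys \<subseteq> L")
  case True
  then show ?thesis using assms by (simp add: alt_forms_def)
next
  case False
  then show ?thesis using assms by (subst (1 2) alt_outside) auto
qed

lemma alt_adjacent: "F \<in> Alt \<Longrightarrow> F (xs @ x # x # ys) = 0"
  by (rule alt_nondistinct) auto

text \<open>Polarising the vanishing on equal neighbours gives a sign for every transposition of
  neighbours, and such transpositions bring any two equal entries together. In inductions over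
  lists, neighbours are easier to handle than \<open>distinct\<close>.\<close>

lemma alt_formsI:
  assumes out: "\<And>xs. \<not> set xs \<subseteq> L \<Longrightarrow> F xs = 0"
    and adj: "\<And>xs x ys. F (xs @ x # x # ys) = 0"
    and add: "\<And>xs ys x y. x \<in> L \<Longrightarrow> y \<in> L \<Longrightarrow> F (xs @ (x + y) # ys) = F (xs @ x # ys) + F (xs @ y # ys)"
    and scale: "\<And>xs ys x k. x \<in> L \<Longrightarrow> F (xs @ sc k x # ys) = k * F (xs @ x # ys)"
  shows "F \<in> Alt"
proof -
  have swap: "F (xs @ x # y # ys) = - F (xs @ y # x # ys)" for xs ys x y
  proof (cases "x \<in> L \<and> y \<in> L")
    case True
    have "0 = F (xs @ (x + y) # (x + y) # ys)" by (simp add: adj)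
    also have "\<dots> = F (xs @ x # (x + y) # ys) + F (xs @ y # (x + y) # ys)"
      using True by (intro add) auto
    also have "\<dots> = F (xs @ x # y # ys) + F (xs @ y # x # ys)"
      using True add[of x y "xs @ [x]" ys] add[of x y "xs @ [y]" ys] adj[of xs x ys] adj[of xs y ys] by simp
    finally show ?thesis by (simp add: eq_neg_iff_add_eq_0)
  next
    case False
    then show ?thesis by (subst (1 2) out) auto
  qed
  have rep: "F (xs @ x # ys @ x # zs) = 0" for xs x ys zs
  proof (induction ys arbitrary: xs)
    case Nil
    then show ?case by (simp add: adj)
  next
    case (Cons y ys)
    then show ?case using swap[of xs x y "ys @ x # zs"] Cons[of "xs @ [y]"] by simp
  qed
  have "F xs = 0" if "\<not> distinct xs" for xs
    using not_distinct_decomp[OF that] rep by auto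
  then show ?thesis using out add scale by (simp add: alt_forms_def)
qed

section \<open>Closure of alternating forms under the operations\<close>

lemma alt_contr: "F \<in> Alt \<Longrightarrow> contr x F \<in> Alt"
  by (rule alt_formsI)
    (use alt_outside[of F "x # _"] alt_adjacent[of F "x # _"] alt_add_arg[of F _ _ "x # _"] alt_scale_arg[of F _ "x # _"]
      in \<open>auto simp: contr_def\<close>)

lemma alt_sgnop: "F \<in> Alt \<Longrightarrow> sgnop F \<in> Alt"
  by (rule alt_formsI)
    (auto simp: sgnop_def alt_outside alt_adjacent alt_add_arg alt_scale_arg algebra_simps)

lemma alt_zero: "(\<lambda>_. 0) \<in> Alt"
  by (rule alt_formsI) auto

lemma alt_add: "F \<in> Alt \<Longrightarrow> G \<in> Alt \<Longrightarrow> (\<lambda>xs. F xs + G xs) \<in> Alt"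
  by (rule alt_formsI) (auto simp: alt_outside alt_adjacent alt_add_arg alt_scale_arg algebra_simps)

lemma alt_scale: "F \<in> Alt \<Longrightarrow> (\<lambda>xs. k * F xs) \<in> Alt"
  by (rule alt_formsI) (auto simp: alt_outside alt_adjacent alt_add_arg alt_scale_arg algebra_simps)

lemma alt_uminus: "F \<in> Alt \<Longrightarrow> (\<lambda>xs. - F xs) \<in> Alt"
  using alt_scale[of F "- 1"] by simp

lemma alt_sum: "(\<And>i. i \<in> I \<Longrightarrow> F i \<in> Alt) \<Longrightarrow> (\<lambda>xs. \<Sum>i\<in>I. F i xs) \<in> Alt"
  by (induction I rule: infinite_finite_induct) (simp_all add: alt_zero alt_add)

lemma contr_add_arg:
  "F \<in> Alt \<Longrightarrow> x \<in> L \<Longrightarrow> y \<in> L \<Longrightarrow> contr (x + y) F = (\<lambda>xs. contr x F xs + contr y F xs)"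
  using alt_add_arg[of F x y "[]"] by (simp add: contr_def fun_eq_iff)

lemma contr_scale_arg:
  "F \<in> Alt \<Longrightarrow> x \<in> L \<Longrightarrow> contr (sc k x) F = (\<lambda>xs. k * contr x F xs)"
  using alt_scale_arg[of F x "[]"] by (simp add: contr_def fun_eq_iff)

lemma contr_contr_same: "F \<in> Alt \<Longrightarrow> contr x (contr x F) = (\<lambda>_. 0)"
  using alt_adjacent[of F "[]"] by (simp add: contr_def)

lemma contr_outside: "F \<in> Alt \<Longrightarrow> x \<notin> L \<Longrightarrow> contr x F = (\<lambda>_. 0)"
  by (simp add: contr_def alt_outside)

text \<open>Polarisation in the first two slots when both vectors lie in \<open>L\<close>; otherwise
  both sides vanish.\<close>

lemma contr_contr_swap:
  assumes "F \<in> Alt"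
  shows "contr x (contr y F) = (\<lambda>xs. - contr y (contr x F) xs)"
proof (cases "x \<in> L \<and> y \<in> L")
  case True
  have "F (x # y # zs) + F (y # x # zs) = 0" for zs
  proof -
    have "F ((x + y) # (x + y) # zs) = F (x # (x + y) # zs) + F (y # (x + y) # zs)"
      using True assms alt_add_arg[of F x y "[]"] by simp
    then show ?thesis
      using True assms alt_add_arg[of F x y "[x]" zs] alt_add_arg[of F x y "[y]" zs]
        alt_adjacent[OF assms, of "[]"] by simp
  qed
  then show ?thesis by (simp add: contr_def fun_eq_iff eq_neg_iff_add_eq_0 add.commute)
next
  case False
  then show ?thesis using assms
    by (auto simp: contr_outside alt_contr) (auto simp: contr_def alt_outside fun_eq_iff)
qed

text \<open>The entries before the position of interest are contracted away. For two equal
  neighbours at the front, the two mixed terms with one contraction on each factor cancel, because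
  \<open>contr\<close> anticommutes with \<open>sgnop\<close>.\<close>

lemma alt_wedge:
  assumes "F \<in> Alt" "G \<in> Alt"
  shows "wedge F G \<in> Alt"
proof (rule alt_formsI)
  fix xs assume "\<not> set xs \<subseteq> L"
  then show "wedge F G xs = 0" using assms
  proof (induction xs arbitrary: F G)
    case (Cons x xs)
    show ?case
    proof (cases "x \<in> L")
      case True
      then show ?thesis using Cons by (simp add: wedge_Cons alt_contr alt_sgnop)
    next
      case False
      then show ?thesis using Cons by (simp add: wedge_Cons contr_outside)
    qed
  qed simp
next
  fix xs x ys show "wedge F G (xs @ x # x # ys) = 0" using assms
  proof (induction xs arbitrary: F G)
    case Nil
    then show ?case
      by (simp add: wedge_Cons contr_contr_same contr_sgnop wedge_minus_left alt_sgnop)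
  next
    case (Cons x xs)
    then show ?case by (simp add: wedge_Cons alt_contr alt_sgnop)
  qed
next
  fix xs ys x y assume "x \<in> L" "y \<in> L"
  with assms show "wedge F G (xs @ (x + y) # ys) = wedge F G (xs @ x # ys) + wedge F G (xs @ y # ys)"
  proof (induction xs arbitrary: F G)
    case Nil
    then show ?case by (simp add: wedge_Cons contr_add_arg wedge_add_left wedge_add_right)
  next
    case (Cons x xs)
    then show ?case by (simp add: wedge_Cons alt_contr alt_sgnop)
  qed
next
  fix xs ys x k assume "x \<in> L"
  with assms show "wedge F G (xs @ sc k x # ys) = k * wedge F G (xs @ x # ys)"
  proof (induction xs arbitrary: F G)
    case Nil
    then show ?case
      by (simp add: wedge_Cons contr_scale_arg wedge_scale_left wedge_scale_right distrib_left)
  next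
    case (Cons x xs)
    then show ?case by (simp add: wedge_Cons alt_contr alt_sgnop distrib_left)
  qed
qed

lemma alt_deg_iff: "F \<in> alt_forms_deg sc L p \<longleftrightarrow> F \<in> Alt \<and> homog p F"
  by (simp add: alt_forms_deg_def homog_def)

section \<open>Forms of degree one and two\<close>

definition lin_form :: "('a \<Rightarrow> 'k) \<Rightarrow> bool" where
  "lin_form g \<longleftrightarrow> (\<forall>x\<in>L. \<forall>y\<in>L. g (x + y) = g x + g y) \<and> (\<forall>k. \<forall>x\<in>L. g (sc k x) = k * g x)"

text \<open>Membership is part of the claim because \<open>g\<close> is additive only on
  \<open>L\<close>, so the induction needs the partial sums to stay there.\<close>

lemma lin_form_sum:
  assumes "lin_form g" "finite I" "\<And>i. i \<in> I \<Longrightarrow> z i \<in> L"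
  shows "(\<Sum>i\<in>I. sc (k i) (z i)) \<in> L \<and> g (\<Sum>i\<in>I. sc (k i) (z i)) = (\<Sum>i\<in>I. k i * g (z i))"
  using assms(2,3)
proof (induction I rule: finite_induct)
  case empty
  have "g (0 + 0) = g 0 + g 0" using assms(1) zero_mem unfolding lin_form_def by blast
  then show ?case by (simp add: zero_mem)
next
  case (insert i I)
  then show ?case using assms(1) by (simp add: lin_form_def add_mem scale_mem)
qed

lemma one_form_alt:
  assumes "lin_form (p w)"
  shows "one_form L p w \<in> Alt"
proof (rule alt_formsI)
  fix xs ys x y assume "x \<in> L" "y \<in> L"
  then show "one_form L p w (xs @ (x + y) # ys) = one_form L p w (xs @ x # ys) + one_form L p w (xs @ y # ys)"
    using assms by (cases xs; cases ys) (auto simp: one_form_def lin_form_def add_mem split: list.splits)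
next
  fix xs ys x k assume "x \<in> L"
  then show "one_form L p w (xs @ sc k x # ys) = k * one_form L p w (xs @ x # ys)"
    using assms by (cases xs; cases ys) (auto simp: one_form_def lin_form_def scale_mem split: list.splits)
qed (auto simp: one_form_def split: list.splits)

definition two_form :: "('a \<Rightarrow> 'a \<Rightarrow> 'k) \<Rightarrow> 'a list \<Rightarrow> 'k" where
  "two_form h xs = (case xs of [x, y] \<Rightarrow> if x \<in> L \<and> y \<in> L then h x y else 0 | _ \<Rightarrow> 0)"

lemma two_form_alt:
  assumes "\<And>x. x \<in> L \<Longrightarrow> lin_form (h x)" "\<And>y. y \<in> L \<Longrightarrow> lin_form (\<lambda>x. h x y)" "\<And>x. x \<in> L \<Longrightarrow> h x x = 0"
  shows "two_form h \<in> Alt"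
proof (rule alt_formsI)
  have two: "two_form h (xs @ x # ys) = (case (xs, ys) of ([], [y]) \<Rightarrow> two_form h [x, y]
      | ([y], []) \<Rightarrow> two_form h [y, x] | _ \<Rightarrow> 0)" for xs x ys
    by (cases xs; cases ys) (auto simp: two_form_def split: list.splits)
  fix xs ys x y assume "x \<in> L" "y \<in> L"
  then show "two_form h (xs @ (x + y) # ys) = two_form h (xs @ x # ys) + two_form h (xs @ y # ys)"
    using assms(1,2) unfolding two by (auto simp: two_form_def lin_form_def add_mem split: list.splits)
next
  have two: "two_form h (xs @ x # ys) = (case (xs, ys) of ([], [y]) \<Rightarrow> two_form h [x, y]
      | ([y], []) \<Rightarrow> two_form h [y, x] | _ \<Rightarrow> 0)" for xs x ys
    by (cases xs; cases ys) (auto simp: two_form_def split: list.splits)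
  fix xs ys x k assume "x \<in> L"
  then show "two_form h (xs @ sc k x # ys) = k * two_form h (xs @ x # ys)"
    using assms(1,2) unfolding two by (auto simp: two_form_def lin_form_def scale_mem split: list.splits)
next
  fix xs x ys show "two_form h (xs @ x # x # ys) = 0"
    using assms(3) by (cases xs; cases ys) (auto simp: two_form_def split: list.splits)
qed (auto simp: two_form_def split: list.splits)

lemma homog_one_form: "homog 1 (one_form L p w)"
  by (auto simp: homog_def one_form_def split: list.splits)

lemma homog_two_form: "homog 2 (two_form h)"
  by (auto simp: homog_def two_form_def split: list.splits)

end

section \<open>Euler's identity and uniqueness of derivations\<close>

text \<open>The scalars inside the exterior algebra, with unit \<open>const_form 1\<close>;
  contracting a 1-form lands here.\<close>

definition const_form :: "'k::zero \<Rightarrow> 'a list \<Rightarrow> 'k" where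
  "const_form k xs = (if xs = [] then k else 0)"

lemma contr_const_form [simp]: "contr x (const_form k) = (\<lambda>_. 0)"
  by (simp add: contr_def const_form_def)

lemma sgnop_const_form [simp]: "sgnop (const_form k) = const_form k"
  by (rule ext) (simp add: sgnop_def const_form_def)

lemma homog_const_form: "homog 0 (const_form k)"
  by (simp add: homog_def const_form_def)

lemma wedge_const_form_left: "wedge (const_form k) G = (\<lambda>xs. k * G xs)"
proof (rule ext)
  fix xs show "wedge (const_form k) G xs = k * G xs"
    by (induction xs arbitrary: G) (simp_all add: wedge_Nil wedge_Cons const_form_def[of k "[]"], simp add: contr_def)
qed

lemma wedge_const_form_right: "wedge G (const_form k) = (\<lambda>xs. k * G xs)"
  using wedge_commute_homog[OF homog_const_form, of k G] by (simp add: wedge_const_form_left)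

text \<open>\<open>e\<close> is a finite frame with coordinate functionals \<open>c\<close>. Euler's
  identity rests on the expansion of a vector in the frame, which is why \<open>frame_expand\<close>
  takes the place of duality relations between \<open>c\<close> and \<open>e\<close>.\<close>

locale framed = scaled_carrier sc L
  for sc :: "'k::field_char_0 \<Rightarrow> 'a::ab_group_add \<Rightarrow> 'a" and L :: "'a set" +
  fixes I :: "'i set" and e :: "'i \<Rightarrow> 'a" and c :: "'i \<Rightarrow> 'a \<Rightarrow> 'k"
  assumes finite_I: "finite I"
    and frame_mem: "i \<in> I \<Longrightarrow> e i \<in> L"
    and coord_lin: "i \<in> I \<Longrightarrow> lin_form (c i)"
    and frame_expand: "x \<in> L \<Longrightarrow> (\<Sum>i\<in>I. sc (c i x) (e i)) = x"
begin

abbreviation "cf \<equiv> one_form L c"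

lemma lin_form_expand:
  assumes "lin_form g" "x \<in> L"
  shows "g x = (\<Sum>i\<in>I. c i x * g (e i))"
  using lin_form_sum[OF assms(1) finite_I, of e "\<lambda>i. c i x"] frame_mem frame_expand[OF assms(2)] by simp

lemma contr_expand:
  assumes "F \<in> Alt" "x \<in> L"
  shows "contr x F = (\<lambda>xs. \<Sum>i\<in>I. c i x * contr (e i) F xs)"
proof (rule ext)
  fix xs
  have "lin_form (\<lambda>x. F (x # xs))"
    using alt_add_arg[OF assms(1), of _ _ "[]"] alt_scale_arg[OF assms(1), of _ "[]"] by (simp add: lin_form_def)
  from lin_form_expand[OF this assms(2)] show "contr x F xs = (\<Sum>i\<in>I. c i x * contr (e i) F xs)"
    by (simp add: contr_def)
qed

text \<open>Contraction is linear in the vector, so the arguments can be expanded in the frame one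
  after the other. This serves for the degree bound and for injectivity of the pullback.\<close>

lemma alt_zeroI_frame:
  assumes "F \<in> Alt" "\<And>js. set js \<subseteq> I \<Longrightarrow> length js = length xs \<Longrightarrow> F (map e js) = 0"
  shows "F xs = 0"
  using assms
proof (induction xs arbitrary: F)
  case Nil
  then show ?case by fastforce
next
  case (Cons x xs)
  show ?case
  proof (cases "x \<in> L")
    case True
    have "contr (e i) F xs = 0" if "i \<in> I" for i
    proof (rule Cons.IH)
      fix js assume "set js \<subseteq> I" "length js = length xs"
      then show "contr (e i) F (map e js) = 0"
        using Cons.prems(2)[of "i # js"] that by (simp add: contr_def)
    qed (use Cons.prems in \<open>simp add: alt_contr\<close>)
    then have "contr x F xs = 0" using contr_expand[OF Cons.prems(1) True] by simp
    then show ?thesis by (simp add: contr_def)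
  next
    case False
    then show ?thesis using alt_outside[OF Cons.prems(1), of "x # xs"] by simp
  qed
qed

text \<open>A list of more than \<open>card I\<close> frame vectors repeats one. Hence every form is
  a finite sum of homogeneous components, which is \<open>sum_comp\<close>.\<close>

lemma alt_degree_bound:
  assumes "F \<in> Alt" "card I < length xs"
  shows "F xs = 0"
proof (rule alt_zeroI_frame[OF assms(1)])
  fix js assume "set js \<subseteq> I" "length js = length xs"
  then have "\<not> distinct js"
    using assms(2) card_mono[OF finite_I, of "set js"] distinct_card[of js] by auto
  then have "\<not> distinct (map e js)" by (simp add: distinct_map)
  then show "F (map e js) = 0" using alt_nondistinct[OF assms(1)] by blast
qed

definition comp :: "nat \<Rightarrow> ('a list \<Rightarrow> 'k) \<Rightarrow> 'a list \<Rightarrow> 'k" where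
  "comp p F = (\<lambda>xs. if length xs = p then F xs else 0)"

lemma homog_comp: "homog p (comp p F)"
  by (simp add: homog_def comp_def)

lemma alt_comp: "F \<in> Alt \<Longrightarrow> comp p F \<in> Alt"
  by (rule alt_formsI) (auto simp: comp_def alt_outside alt_adjacent alt_add_arg alt_scale_arg)

lemma sum_comp:
  assumes "F \<in> Alt"
  shows "F = (\<lambda>xs. \<Sum>p\<le>card I. comp p F xs)"
proof (rule ext)
  fix xs show "F xs = (\<Sum>p\<le>card I. comp p F xs)"
    using alt_degree_bound[OF assms, of xs] by (auto simp: comp_def sum.delta' not_le)
qed

lemma cf_alt: "i \<in> I \<Longrightarrow> cf i \<in> Alt"
  by (simp add: one_form_alt coord_lin)

lemma contr_cf: "contr x (cf i) = const_form (if x \<in> L then c i x else 0)"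
  by (rule ext) (simp add: contr_def one_form_def const_form_def split: list.split)

lemma const_form_alt: "const_form k \<in> Alt"
  by (rule alt_formsI) (auto simp: const_form_def)

lemma sgnop_cf: "sgnop (cf i) = (\<lambda>xs. - cf i xs)"
  using sgnop_homog[OF homog_one_form] by simp

text \<open>Evaluation at a first vector \<open>x\<close> gives two sums. Contracting the coordinate
  forms yields \<open>contr x F\<close> once, by the expansion of \<open>x\<close>; contracting the
  other factor yields, after exchanging \<open>x\<close> and \<open>e i\<close>, the identity for
  \<open>contr x F\<close> on a shorter list. Reading the degree off as \<open>length xs\<close>
  covers inhomogeneous \<open>F\<close>.\<close>

lemma euler:
  assumes "F \<in> Alt"
  shows "(\<Sum>i\<in>I. wedge (cf i) (contr (e i) F) xs) = of_nat (length xs) * F xs"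
  using assms
proof (induction xs arbitrary: F)
  case Nil
  then show ?case by (simp add: wedge_Nil one_form_def)
next
  case (Cons x xs)
  show ?case
  proof (cases "x \<in> L")
    case True
    have "(\<Sum>i\<in>I. wedge (cf i) (contr (e i) F) (x # xs))
        = (\<Sum>i\<in>I. c i x * contr (e i) F xs) + (\<Sum>i\<in>I. wedge (cf i) (contr (e i) (contr x F)) xs)"
      using True Cons.prems
      by (simp add: wedge_Cons contr_cf wedge_const_form_left sgnop_cf wedge_minus_left
          contr_contr_swap[of F x] wedge_minus_right sum.distrib)
    also have "\<dots> = contr x F xs + of_nat (length xs) * contr x F xs"
      using Cons.IH[of "contr x F"] Cons.prems
      by (simp add: alt_contr fun_cong[OF contr_expand[OF Cons.prems True], symmetric])
    finally show ?thesis by (simp add: contr_def algebra_simps)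
  next
    case False
    have "wedge (cf i) (contr (e i) F) (x # xs) = 0" if "i \<in> I" for i
      by (rule alt_outside) (use that False Cons.prems in \<open>auto simp: alt_wedge cf_alt alt_contr\<close>)
    then show ?thesis using False alt_outside[OF Cons.prems, of "x # xs"] by simp
  qed
qed

section \<open>Derivations are determined on 1-forms\<close>

lemma linear_op_scale:
  "linear_op sc L T \<Longrightarrow> F \<in> Alt \<Longrightarrow> T (\<lambda>xs. k * F xs) = (\<lambda>xs. k * T F xs)"
  by (simp add: linear_op_def)

lemma linear_op_zero: "linear_op sc L T \<Longrightarrow> T (\<lambda>_. 0) = (\<lambda>_. 0)"
  using linear_op_scale[OF _ alt_zero, of T 0] by simp

lemma linear_op_sum:
  assumes "linear_op sc L T" "\<And>i. i \<in> S \<Longrightarrow> F i \<in> Alt"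
  shows "T (\<lambda>xs. \<Sum>i\<in>S. F i xs) = (\<lambda>xs. \<Sum>i\<in>S. T (F i) xs)"
  using assms(2)
proof (induction S rule: infinite_finite_induct)
  case (insert i S)
  then show ?case using assms(1) by (simp add: linear_op_def alt_sum)
qed (simp_all add: linear_op_zero[OF assms(1)])

text \<open>Euler's identity writes a homogeneous form of positive degree through forms of lower
  degree wedged with coordinate forms, so the unit and the \<open>cf i\<close> generate. The sums
  are indexed by natural numbers because one fixed index type has to serve both for the frame and
  for the degrees.\<close>

lemma euler_induct [consumes 1, case_names const wedge sum scale]:
  assumes "F \<in> Alt"
    and const: "P (const_form 1)"
    and wedge: "\<And>i F. i \<in> I \<Longrightarrow> F \<in> Alt \<Longrightarrow> P F \<Longrightarrow> P (wedge (cf i) F)"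
    and sum: "\<And>(S :: nat set) F. finite S \<Longrightarrow> (\<And>n. n \<in> S \<Longrightarrow> F n \<in> Alt \<and> P (F n)) \<Longrightarrow> P (\<lambda>xs. \<Sum>n\<in>S. F n xs)"
    and scale: "\<And>k F. F \<in> Alt \<Longrightarrow> P F \<Longrightarrow> P (\<lambda>xs. k * F xs)"
  shows "P F"
proof -
  have hom: "P F" if "F \<in> Alt" "homog p F" for p F
    using that
  proof (induction p arbitrary: F)
    case 0
    have "P (\<lambda>xs. F [] * const_form 1 xs)" by (intro scale const const_form_alt)
    moreover have "(\<lambda>xs. F [] * const_form 1 xs) = F"
      using 0 by (auto simp: const_form_def homog_def fun_eq_iff)
    ultimately show ?case by simp
  next
    case (Suc p)
    \<comment> \<open>The frame is enumerated to match the index type in the hypothesis on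
      sums.\<close>
    obtain h :: "nat \<Rightarrow> 'i" and n where h: "bij_betw h {..<n} I"
      using ex_bij_betw_nat_finite[OF finite_I] by (metis atLeast0LessThan)
    let ?W = "\<lambda>m. wedge (cf (h m)) (contr (e (h m)) F)"
    have W: "?W m \<in> Alt \<and> P (?W m)" if "m \<in> {..<n}" for m
    proof -
      have m: "h m \<in> I" using that bij_betwE[OF h] by blast
      have "P (contr (e (h m)) F)" using Suc by (intro Suc.IH alt_contr homog_contr)
      then show ?thesis using m Suc.prems by (simp add: wedge alt_wedge cf_alt alt_contr)
    qed
    \<comment> \<open>Euler's identity divided by the degree; on lists of another length both sides
      are 0.\<close>
    have "F = (\<lambda>xs. (1 / of_nat (Suc p)) * (\<Sum>i\<in>I. wedge (cf i) (contr (e i) F) xs))"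
    proof (rule ext)
      fix xs show "F xs = (1 / of_nat (Suc p)) * (\<Sum>i\<in>I. wedge (cf i) (contr (e i) F) xs)"
        using Suc.prems by (cases "length xs = Suc p") (simp_all add: euler homog_def del: of_nat_Suc)
    qed
    also have "\<dots> = (\<lambda>xs. (1 / of_nat (Suc p)) * (\<Sum>m<n. ?W m xs))"
      by (simp add: sum.reindex_bij_betw[OF h, of "\<lambda>i. wedge (cf i) (contr (e i) F) _"])
    finally have F: "F = (\<lambda>xs. (1 / of_nat (Suc p)) * (\<Sum>m<n. ?W m xs))" .
    have "P (\<lambda>xs. (1 / of_nat (Suc p)) * (\<Sum>m<n. ?W m xs))"
      using W by (intro scale sum alt_sum) auto
    then show ?case using F by simp
  qed
  have "P (\<lambda>xs. \<Sum>p\<in>{..card I}. comp p F xs)"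
    by (intro sum) (auto intro: hom alt_comp homog_comp assms(1))
  then show ?thesis using sum_comp[OF assms(1)] by simp
qed

text \<open>By \<open>euler_induct\<close> it is enough to follow multiplication by a coordinate
  form. The sign \<open>s\<close> is left open: it is \<open>- 1\<close> for the differential and
  \<open>(- 1) ^ (m + 1)\<close> for the bracket with a form of degree \<open>m\<close>.\<close>

lemma derivation_unique:
  assumes "linear_op sc L T" "linear_op sc L T'"
    and "T (const_form 1) = T' (const_form 1)"
    and "\<And>i. i \<in> I \<Longrightarrow> T (cf i) = T' (cf i)"
    and "\<And>i G. i \<in> I \<Longrightarrow> G \<in> Alt \<Longrightarrow> T (wedge (cf i) G) = (\<lambda>xs. wedge (T (cf i)) G xs + s * wedge (cf i) (T G) xs)"
    and "\<And>i G. i \<in> I \<Longrightarrow> G \<in> Alt \<Longrightarrow> T' (wedge (cf i) G) = (\<lambda>xs. wedge (T' (cf i)) G xs + s * wedge (cf i) (T' G) xs)"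
    and "F \<in> Alt"
  shows "T F = T' F"
  using assms(7)
proof (induction F rule: euler_induct)
  case const
  show ?case by (rule assms(3))
next
  case (wedge i F)
  then show ?case using assms by simp
next
  case (sum S F)
  have "T (\<lambda>xs. \<Sum>n\<in>S. F n xs) = (\<lambda>xs. \<Sum>n\<in>S. T (F n) xs)"
    "T' (\<lambda>xs. \<Sum>n\<in>S. F n xs) = (\<lambda>xs. \<Sum>n\<in>S. T' (F n) xs)"
    using sum by (intro linear_op_sum assms(1,2); blast)+
  then show ?case using sum by (simp cong: sum.cong)
next
  case (scale k F)
  then show ?case using assms by (simp add: linear_op_scale)
qed

end

lemma (in framed) one_homog_alt_eqI:
  assumes "F \<in> Alt" "G \<in> Alt" "homog 1 F" "homog 1 G" "\<And>x. x \<in> L \<Longrightarrow> F [x] = G [x]"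
  shows "F = G"
proof (rule ext)
  fix xs
  show "F xs = G xs"
  proof (cases "length xs = 1")
    case True
    then obtain x where "xs = [x]" by (auto simp: length_Suc_conv)
    then show ?thesis using assms by (cases "x \<in> L") (auto simp: alt_outside)
  qed (use assms in \<open>simp add: homog_def\<close>)
qed

lemma (in framed) two_homog_alt_eqI:
  assumes "F \<in> Alt" "G \<in> Alt" "homog 2 F" "homog 2 G" "\<And>x y. x \<in> L \<Longrightarrow> y \<in> L \<Longrightarrow> F [x, y] = G [x, y]"
  shows "F = G"
proof (rule ext)
  fix xs
  show "F xs = G xs"
  proof (cases "length xs = 2")
    case True
    then obtain x y where "xs = [x, y]" by (auto simp: length_Suc_conv numeral_2_eq_2)
    then show ?thesis using assms by (cases "x \<in> L \<and> y \<in> L") (auto simp: alt_outside)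
  qed (use assms in \<open>simp add: homog_def\<close>)
qed

section \<open>The Chevalley-Eilenberg differential in a frame\<close>

locale framed_bracket = framed sc L I e c
  for sc :: "'k::field_char_0 \<Rightarrow> 'a::ab_group_add \<Rightarrow> 'a" and L and I :: "'i set" and e c +
  fixes br :: "'a \<Rightarrow> 'a \<Rightarrow> 'a"
  assumes br_mem: "x \<in> L \<Longrightarrow> y \<in> L \<Longrightarrow> br x y \<in> L"
    and br_self: "x \<in> L \<Longrightarrow> br x x = 0"
    and br_add_left: "x \<in> L \<Longrightarrow> y \<in> L \<Longrightarrow> z \<in> L \<Longrightarrow> br (x + y) z = br x z + br y z"
    and br_add_right: "x \<in> L \<Longrightarrow> y \<in> L \<Longrightarrow> z \<in> L \<Longrightarrow> br x (y + z) = br x y + br x z"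
    and br_scale_left: "x \<in> L \<Longrightarrow> y \<in> L \<Longrightarrow> br (sc k x) y = sc k (br x y)"
    and br_scale_right: "x \<in> L \<Longrightarrow> y \<in> L \<Longrightarrow> br x (sc k y) = sc k (br x y)"
begin

definition dcf :: "'i \<Rightarrow> 'a list \<Rightarrow> 'k" where
  "dcf i = two_form (\<lambda>x y. - c i (br x y))"

definition ce :: "('a list \<Rightarrow> 'k) \<Rightarrow> 'a list \<Rightarrow> 'k" where
  "ce F = (\<lambda>xs. \<Sum>i\<in>I. wedge (dcf i) (contr (e i) F) xs)"

lemma lin_form_0: "lin_form g \<Longrightarrow> g 0 = 0"
  using zero_mem unfolding lin_form_def by (metis add.right_neutral add_cancel_right_right)

lemma dcf_alt: "i \<in> I \<Longrightarrow> dcf i \<in> Alt"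
  unfolding dcf_def
  by (rule two_form_alt)
    (use coord_lin[of i] lin_form_0[OF coord_lin, of i] in
      \<open>auto simp: lin_form_def br_mem br_self br_add_left br_add_right br_scale_left br_scale_right\<close>)

lemma homog_dcf: "homog 2 (dcf i)"
  unfolding dcf_def by (rule homog_two_form)

lemma ce_alt: "F \<in> Alt \<Longrightarrow> ce F \<in> Alt"
  unfolding ce_def by (intro alt_sum alt_wedge dcf_alt alt_contr)

lemma ce_linear: "linear_op sc L ce"
  unfolding linear_op_def
  by (auto simp: ce_alt) (simp_all add: ce_def contr_add contr_scale wedge_add_right wedge_scale_right sum.distrib sum_distrib_left)

lemma ce_homog:
  assumes "homog p F" shows "homog (Suc p) (ce F)"
proof (cases p)
  case 0
  then show ?thesis using assms by (simp add: ce_def homog_0_contr)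
next
  case (Suc q)
  have "homog (2 + q) (ce F)" unfolding ce_def
    using assms Suc by (intro homog_sum homog_wedge homog_dcf homog_contr) auto
  then show ?thesis using Suc by simp
qed

text \<open>Contraction is an odd derivation, and \<open>dcf i\<close> has even degree, so it moves
  past \<open>F\<close> without a sign.\<close>

lemma ce_wedge:
  assumes "homog p F"
  shows "ce (wedge F G) = (\<lambda>xs. wedge (ce F) G xs + (- 1) ^ p * wedge F (ce G) xs)"
proof -
  have "wedge (dcf i) (wedge F H) = wedge F (wedge (dcf i) H)" for i H
    using wedge_commute_homog[OF homog_dcf, of i F]
    by (simp add: wedge_assoc[symmetric] numeral_2_eq_2)
  then show ?thesis
    by (simp add: ce_def contr_wedge sgnop_homog[OF assms] wedge_add_right wedge_scale_left wedge_scale_right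
        wedge_sum_left wedge_sum_right wedge_assoc sum.distrib sum_distrib_left)
qed

text \<open>The contractions of a 1-form are the scalars \<open>F [e i]\<close>; weighted by the
  coordinates of \<open>br x y\<close> they reassemble \<open>F [br x y]\<close>.\<close>

lemma ce_one:
  assumes "F \<in> Alt" "homog 1 F" "x \<in> L" "y \<in> L"
  shows "ce F [x, y] = - F [br x y]"
proof -
  have "ce F [x, y] = (\<Sum>i\<in>I. - c i (br x y) * F [e i])"
    using assms(2-) by (simp add: ce_def wedge_two dcf_def two_form_def contr_def homog_def)
  also have "\<dots> = - F [br x y]"
    using fun_cong[OF contr_expand[OF assms(1) br_mem[OF assms(3,4)]], of "[]"] by (simp add: contr_def sum_negf)
  finally show ?thesis .
qed

lemma ce_is_ce_differential: "is_ce_differential sc L br ce"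
  unfolding is_ce_differential_def
  using ce_linear ce_wedge ce_one by (auto simp: alt_deg_iff ce_alt ce_homog)

lemma ce_differential_unique:
  assumes D: "is_ce_differential sc L br D" and "F \<in> Alt"
  shows "D F = ce F"
proof (rule derivation_unique[where s = "- 1", OF _ ce_linear _ _ _ _ assms(2)])
  show D_lin: "linear_op sc L D" using D by (simp add: is_ce_differential_def)
  have wedge_rule: "D (wedge F G) = (\<lambda>xs. wedge (D F) G xs + (- 1) ^ p * wedge F (D G) xs)"
    if "F \<in> Alt" "homog p F" "G \<in> Alt" for F G p
  proof -
    have "F \<in> alt_forms_deg sc L p" using that by (simp add: alt_deg_iff)
    then show ?thesis using D that(3) unfolding is_ce_differential_def by blast
  qed
  \<comment> \<open>The derivation rule for the product of the unit with itself reads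
    \<open>D 1 = D 1 + D 1\<close>.\<close>
  have "D (const_form 1) xs = 0" for xs
    using fun_cong[OF wedge_rule[OF const_form_alt[of 1] homog_const_form const_form_alt[of 1]], of xs]
    by (simp add: wedge_const_form_left wedge_const_form_right)
  then have "D (const_form 1) = (\<lambda>_. 0)" by (rule ext)
  then show "D (const_form 1) = ce (const_form 1)" by (simp add: ce_def)
  fix i assume i: "i \<in> I"
  have deg: "cf i \<in> alt_forms_deg sc L 1" using cf_alt[OF i] homog_one_form by (simp add: alt_deg_iff del: One_nat_def)
  then have "D (cf i) \<in> alt_forms_deg sc L (Suc 1)" using D unfolding is_ce_differential_def by blast
  then have "D (cf i) \<in> Alt \<and> homog 2 (D (cf i))" by (simp add: alt_deg_iff numeral_2_eq_2)
  moreover have "D (cf i) [x, y] = - cf i [br x y]" if "x \<in> L" "y \<in> L" for x y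
    using D that deg unfolding is_ce_differential_def by blast
  ultimately show "D (cf i) = ce (cf i)"
    using i ce_one[OF cf_alt homog_one_form] ce_homog[OF homog_one_form, of c i] ce_alt[OF cf_alt]
    by (intro two_homog_alt_eqI) (auto simp: numeral_2_eq_2)
  fix G assume "G \<in> Alt"
  then show "D (wedge (cf i) G) = (\<lambda>xs. wedge (D (cf i)) G xs + - 1 * wedge (cf i) (D G) xs)"
    "ce (wedge (cf i) G) = (\<lambda>xs. wedge (ce (cf i)) G xs + - 1 * wedge (cf i) (ce G) xs)"
    using wedge_rule[OF cf_alt[OF i] homog_one_form] ce_wedge[OF homog_one_form] by simp_all
qed

end

section \<open>The Gerstenhaber bracket in a frame\<close>

text \<open>\<open>p\<close> turns elements of \<open>W\<close> into 1-forms on \<open>L\<close>,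
  and \<open>w i\<close> represents the coordinate functional \<open>c i\<close>. The type of
  \<open>W\<close> carries no linear structure here, so antisymmetry and bilinearity of
  \<open>wbr\<close> are expressed after pairing with \<open>L\<close>.\<close>

locale framed_dual = framed sc L I e c
  for sc :: "'k::field_char_0 \<Rightarrow> 'a::ab_group_add \<Rightarrow> 'a" and L and I :: "'i set" and e c +
  fixes W :: "'w set" and p :: "'w \<Rightarrow> 'a \<Rightarrow> 'k" and wbr :: "'w \<Rightarrow> 'w \<Rightarrow> 'w" and w :: "'i \<Rightarrow> 'w"
  assumes w_mem: "i \<in> I \<Longrightarrow> w i \<in> W"
    and p_w: "i \<in> I \<Longrightarrow> x \<in> L \<Longrightarrow> p (w i) x = c i x"
    and p_lin: "v \<in> W \<Longrightarrow> lin_form (p v)"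
    and wbr_mem: "u \<in> W \<Longrightarrow> v \<in> W \<Longrightarrow> wbr u v \<in> W"
    and wbr_anti: "u \<in> W \<Longrightarrow> v \<in> W \<Longrightarrow> x \<in> L \<Longrightarrow> p (wbr u v) x = - p (wbr v u) x"
    and wbr_expand: "u \<in> W \<Longrightarrow> v \<in> W \<Longrightarrow> x \<in> L \<Longrightarrow>
      p (wbr u v) x = (\<Sum>i\<in>I. \<Sum>j\<in>I. p u (e i) * p v (e j) * p (wbr (w i) (w j)) x)"
begin

definition wform :: "'i \<Rightarrow> 'i \<Rightarrow> 'a list \<Rightarrow> 'k" where
  "wform i j = one_form L p (wbr (w i) (w j))"

text \<open>On \<open>F\<close> of degree \<open>p\<close> the operator \<open>sgnop\<close> supplies the sign \<open>(- 1)\<^sup>p\<^sup>-\<^sup>1\<close> that graded antisymmetry demands.\<close>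

definition gb :: "('a list \<Rightarrow> 'k) \<Rightarrow> ('a list \<Rightarrow> 'k) \<Rightarrow> 'a list \<Rightarrow> 'k" where
  "gb F G = (\<lambda>xs. \<Sum>i\<in>I. \<Sum>j\<in>I. wedge (sgnop (contr (e i) F)) (wedge (wform i j) (contr (e j) G)) xs)"

lemma wform_alt: "i \<in> I \<Longrightarrow> j \<in> I \<Longrightarrow> wform i j \<in> Alt"
  unfolding wform_def by (intro one_form_alt p_lin wbr_mem w_mem)

lemma homog_wform: "homog 1 (wform i j)"
  unfolding wform_def by (rule homog_one_form)

lemma wform_swap: "i \<in> I \<Longrightarrow> j \<in> I \<Longrightarrow> wform j i = (\<lambda>xs. - wform i j xs)"
  using wbr_anti[OF w_mem w_mem, of j i] by (auto simp: wform_def one_form_def fun_eq_iff split: list.split)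

lemma gb_alt: "F \<in> Alt \<Longrightarrow> G \<in> Alt \<Longrightarrow> gb F G \<in> Alt"
  unfolding gb_def by (intro alt_sum alt_wedge alt_contr alt_sgnop wform_alt)

lemma gb_linear:
  assumes "F \<in> Alt" shows "linear_op sc L (gb F)" "linear_op sc L (\<lambda>G. gb G F)"
  unfolding linear_op_def using assms
  by (auto simp: gb_alt)
    (simp_all add: gb_def contr_add contr_scale sgnop_add sgnop_scale wedge_add_left wedge_scale_left
      wedge_add_right wedge_scale_right sum.distrib sum_distrib_left)

lemma gb_homog:
  assumes "homog m F" "homog n G"
  shows "homog (m + n - 1) (gb F G)"
proof (cases "m = 0 \<or> n = 0")
  case True
  then have "gb F G = (\<lambda>_. 0)"
    using assms by (auto simp: gb_def homog_0_contr sgnop_def)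
  then show ?thesis by simp
next
  case False
  then obtain m' n' where mn: "m = Suc m'" "n = Suc n'" by (metis not0_implies_Suc)
  have "homog (m' + (1 + n')) (gb F G)" unfolding gb_def
    using assms mn by (intro homog_sum homog_wedge homog_wform homog_sgnop homog_contr) auto
  then show ?thesis using mn by simp
qed

text \<open>Termwise, graded commutativity reverses the order of the three factors, the 1-form in
  the middle changes sign by \<open>wform_swap\<close>, and the summation indices are exchanged. If
  a degree is 0, both sides vanish, since contraction kills scalars.\<close>

lemma gb_anti:
  assumes "homog m F" "homog n G"
  shows "gb F G = (\<lambda>xs. - ((- 1) ^ ((m + 1) * (n + 1))) * gb G F xs)"
proof (cases "m = 0 \<or> n = 0")
  case True
  then have "gb F G = (\<lambda>_. 0)" "gb G F = (\<lambda>_. 0)"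
    using assms by (auto simp: gb_def homog_0_contr sgnop_def)
  then show ?thesis by simp
next
  case False
  then obtain m' n' where mn: "m = Suc m'" "n = Suc n'" by (metis not0_implies_Suc)
  have t: "wedge (sgnop (contr (e i) F)) (wedge (wform i j) (contr (e j) G)) =
    (\<lambda>xs. - ((- 1) ^ ((m + 1) * (n + 1))) * wedge (sgnop (contr (e j) G)) (wedge (wform j i) (contr (e i) F)) xs)"
    (is "?l = ?r") if "i \<in> I" "j \<in> I" for i j
  proof -
    have hF: "homog m' (contr (e i) F)" and hG: "homog n' (contr (e j) G)"
      using assms mn homog_contr by auto
    have "?l = (\<lambda>xs. (- 1) ^ m' * wedge (contr (e i) F) (wedge (wform i j) (contr (e j) G)) xs)"
      by (simp add: sgnop_homog[OF hF] wedge_scale_left)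
    also have "\<dots> = (\<lambda>xs. (- 1) ^ (m' + m' * (1 + n')) * wedge (wedge (wform i j) (contr (e j) G)) (contr (e i) F) xs)"
      using wedge_commute[OF hF homog_wedge[OF homog_wform hG]] by (simp add: power_add mult.assoc)
    also have "\<dots> = (\<lambda>xs. (- 1) ^ (m' + m' * (1 + n') + n') * wedge (contr (e j) G) (wedge (wform i j) (contr (e i) F)) xs)"
      using wedge_commute[OF homog_wform hG, of i j] by (simp add: power_add mult.assoc wedge_assoc wedge_scale_left)
    also have "\<dots> = ?r"
    proof -
      \<comment> \<open>\<open>m'\<close> and \<open>n'\<close> are the degrees of the contracted
        forms; the extra \<open>(- 1) ^ n'\<close> is the sign hidden in
        \<open>sgnop (contr (e j) G)\<close>.\<close>
      have "(- 1 :: 'k) ^ (m' + m' * (1 + n') + n') = (- 1) ^ ((m + 1) * (n + 1)) * (- 1) ^ n'"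
        unfolding power_add[symmetric] by (rule minus_one_power_eq_of_parity) (auto simp: mn)
      then show ?thesis using wform_swap[OF that]
        by (simp add: sgnop_homog[OF hG] wedge_scale_left wedge_minus_left wedge_minus_right mult.assoc)
    qed
    finally show ?thesis .
  qed
  show ?thesis
    unfolding gb_def by (subst (2) sum.swap) (simp add: t sum_distrib_left cong: sum.cong)
qed

text \<open>Contraction with \<open>e j\<close> acts on the product as an odd derivation. In the
  second summand \<open>G\<close> passes a factor of degree \<open>m\<close>, the contracted
  \<open>F\<close> times a 1-form; together with the sign from \<open>sgnop G\<close> this costs
  \<open>(- 1) ^ ((m + 1) * n)\<close>.\<close>

lemma gb_wedge:
  assumes "homog m F" "homog n G"
  shows "gb F (wedge G H) = (\<lambda>xs. wedge (gb F G) H xs + (- 1) ^ ((m + 1) * n) * wedge G (gb F H) xs)"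
proof (cases "m = 0")
  case True
  then show ?thesis
    using assms by (auto simp: gb_def homog_0_contr sgnop_def)
next
  case False
  then obtain m' where m: "m = Suc m'" by (metis not0_implies_Suc)
  have t: "wedge (sgnop (contr (e i) F)) (wedge (wform i j) (wedge (sgnop G) (contr (e j) H))) =
    (\<lambda>xs. (- 1) ^ ((m + 1) * n) * wedge G (wedge (sgnop (contr (e i) F)) (wedge (wform i j) (contr (e j) H))) xs)"
    (is "?l = ?r") for i j
  proof -
    have h: "homog (m' + 1) (wedge (sgnop (contr (e i) F)) (wform i j))"
      using assms m by (intro homog_wedge homog_wform homog_sgnop homog_contr) auto
    have "?l = (\<lambda>xs. (- 1) ^ n * wedge (wedge (wedge (sgnop (contr (e i) F)) (wform i j)) G) (contr (e j) H) xs)"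
      by (simp add: sgnop_homog[OF assms(2)] wedge_scale_left wedge_scale_right wedge_assoc)
    also have "\<dots> = ?r"
      unfolding wedge_commute[OF h assms(2)]
      by (simp add: m wedge_scale_left wedge_assoc power_add algebra_simps)
    finally show ?thesis .
  qed
  show ?thesis
    by (simp add: gb_def contr_wedge wedge_add_right wedge_sum_left wedge_sum_right wedge_assoc t
        sum.distrib sum_distrib_left)
qed

text \<open>Contractions of 1-forms are scalars, so the double sum becomes the one in
  \<open>wbr_expand\<close>.\<close>

lemma gb_one:
  assumes "u \<in> W" "v \<in> W"
  shows "gb (one_form L p u) (one_form L p v) = one_form L p (wbr u v)"
proof (rule one_homog_alt_eqI)
  show "gb (one_form L p u) (one_form L p v) \<in> Alt"
    using assms by (intro gb_alt one_form_alt p_lin)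
  show "homog 1 (gb (one_form L p u) (one_form L p v))"
    using gb_homog[OF homog_one_form homog_one_form, of p u p v] by simp
  fix x assume x: "x \<in> L"
  then show "gb (one_form L p u) (one_form L p v) [x] = one_form L p (wbr u v) [x]"
    using assms frame_mem
    by (simp add: gb_def wedge_one wedge_Nil contr_def sgnop_def wform_def)
      (simp add: one_form_def wbr_expand algebra_simps cong: sum.cong)
qed (use assms in \<open>simp_all add: homog_one_form one_form_alt p_lin wbr_mem del: One_nat_def\<close>)

lemma gb_is_gerstenhaber: "is_gerstenhaber_bracket sc L W p wbr gb"
  unfolding is_gerstenhaber_bracket_def
proof (intro conjI ballI allI)
  fix m n F G assume "F \<in> alt_forms_deg sc L m" "G \<in> alt_forms_deg sc L n"
  then have FG: "F \<in> Alt" "homog m F" "G \<in> Alt" "homog n G" by (simp_all add: alt_deg_iff)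
  show "gb F G \<in> alt_forms_deg sc L (m + n - 1)"
    using gb_alt[OF FG(1,3)] gb_homog[OF FG(2,4)] by (simp add: alt_deg_iff)
  show "gb F G = (\<lambda>xs. - ((- 1) ^ ((m + 1) * (n + 1))) * gb G F xs)"
    by (rule gb_anti[OF FG(2,4)])
  fix H
  show "gb F (wedge G H) = (\<lambda>xs. wedge (gb F G) H xs + (- 1) ^ ((m + 1) * n) * wedge G (gb F H) xs)"
    by (rule gb_wedge[OF FG(2,4)])
qed (use gb_linear gb_one in blast)+

lemma cf_eq_one_form: "i \<in> I \<Longrightarrow> cf i = one_form L p (w i)"
  by (auto simp: one_form_def p_w fun_eq_iff split: list.split)

text \<open>The derivation rule concerns the second argument. Agreement on coordinate forms is
  therefore extended to all second arguments, graded antisymmetry moves the arbitrary form to the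
  first place, and the rule is used once more; linearity finally covers an inhomogeneous
  \<open>F\<close>.\<close>

lemma gerstenhaber_unique:
  assumes B: "is_gerstenhaber_bracket sc L W p wbr B" and F: "F \<in> Alt" and G: "G \<in> Alt"
  shows "B F G = gb F G"
proof -
  have lin: "linear_op sc L (B F)" "linear_op sc L (\<lambda>G. B G F)" if "F \<in> Alt" for F
    using B that unfolding is_gerstenhaber_bracket_def by blast+
  have anti: "B F G = (\<lambda>xs. - ((- 1) ^ ((m + 1) * (n + 1))) * B G F xs)"
    if "F \<in> Alt" "G \<in> Alt" "homog m F" "homog n G" for F G m n
  proof -
    have "F \<in> alt_forms_deg sc L m" "G \<in> alt_forms_deg sc L n" using that by (simp_all add: alt_deg_iff)
    then show ?thesis using B unfolding is_gerstenhaber_bracket_def by blast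
  qed
  have wedge_rule: "B F (wedge G H) = (\<lambda>xs. wedge (B F G) H xs + (- 1) ^ ((m + 1) * n) * wedge G (B F H) xs)"
    if "F \<in> Alt" "G \<in> Alt" "H \<in> Alt" "homog m F" "homog n G" for F G H m n
  proof -
    have "F \<in> alt_forms_deg sc L m" "G \<in> alt_forms_deg sc L n" using that by (simp_all add: alt_deg_iff)
    then show ?thesis using B that(3) unfolding is_gerstenhaber_bracket_def by blast
  qed
  \<comment> \<open>Bracketing with a fixed \<open>F\<close> of degree \<open>m\<close> is a
    derivation with sign \<open>(- 1) ^ (m + 1)\<close>, hence determined by its values on
    coordinate forms.\<close>
  have step: "B F G = gb F G"
    if F: "F \<in> Alt" "homog m F" and G: "G \<in> Alt" and cf: "\<And>i. i \<in> I \<Longrightarrow> B F (cf i) = gb F (cf i)"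
    for F G m
  proof (rule derivation_unique[where T = "B F" and T' = "gb F" and F = G and s = "(- 1) ^ (m + 1)"])
    have "B F (const_form 1) xs = 0" for xs
      using fun_cong[OF wedge_rule[OF F(1) const_form_alt[of 1] const_form_alt[of 1] F(2) homog_const_form], of xs]
      by (simp add: wedge_const_form_left wedge_const_form_right)
    then have "B F (const_form 1) = (\<lambda>_. 0)" by (rule ext)
    then show "B F (const_form 1) = gb F (const_form 1)" by (simp add: gb_def)
    fix i H assume i: "i \<in> I"
    show "B F (cf i) = gb F (cf i)" by (rule cf[OF i])
    assume H: "H \<in> Alt"
    show "B F (wedge (cf i) H) = (\<lambda>xs. wedge (B F (cf i)) H xs + (- 1) ^ (m + 1) * wedge (cf i) (B F H) xs)"
      using wedge_rule[OF F(1) cf_alt[OF i] H F(2) homog_one_form] by simp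
    show "gb F (wedge (cf i) H) = (\<lambda>xs. wedge (gb F (cf i)) H xs + (- 1) ^ (m + 1) * wedge (cf i) (gb F H) xs)"
      using gb_wedge[OF F(2) homog_one_form] by simp
  qed (use lin(1) gb_linear(1) F G in auto)
  have cf_cf: "B (cf i) (cf j) = gb (cf i) (cf j)" if "i \<in> I" "j \<in> I" for i j
  proof -
    have "B (one_form L p (w i)) (one_form L p (w j)) = one_form L p (wbr (w i) (w j))"
      using B that w_mem unfolding is_gerstenhaber_bracket_def by blast
    then show ?thesis using that gb_one w_mem by (simp add: cf_eq_one_form)
  qed
  have cf_any: "B F (cf i) = gb F (cf i)" if "i \<in> I" "F \<in> Alt" "homog m F" for i F m
  proof -
    have "B (cf i) F = gb (cf i) F"
      by (rule step[OF cf_alt[OF that(1)] homog_one_form that(2)]) (rule cf_cf[OF that(1)])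
    then show ?thesis
      unfolding anti[OF that(2) cf_alt[OF that(1)] that(3) homog_one_form]
        gb_anti[OF that(3) homog_one_form[of c i]] by simp
  qed
  have hom: "B F G = gb F G" if "F \<in> Alt" "homog m F" for F m
    by (rule step[OF that G]) (rule cf_any[OF _ that])
  have "B (\<lambda>xs. \<Sum>p\<le>card I. comp p F xs) G = (\<lambda>xs. \<Sum>p\<le>card I. B (comp p F) G xs)"
    using linear_op_sum[OF lin(2)[OF G], of "{..card I}" "\<lambda>p. comp p F"] alt_comp[OF F] by simp
  also have "\<dots> = (\<lambda>xs. \<Sum>p\<le>card I. gb (comp p F) G xs)"
    using hom[OF alt_comp[OF F] homog_comp] by simp
  also have "\<dots> = gb (\<lambda>xs. \<Sum>p\<le>card I. comp p F xs) G"
    using linear_op_sum[OF gb_linear(2)[OF G], of "{..card I}" "\<lambda>p. comp p F"] alt_comp[OF F] by simp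
  finally show ?thesis by (simp only: sum_comp[OF F, symmetric])
qed

end

section \<open>Pulling back along a real form\<close>

text \<open>The frame of \<open>L\<close> is the image under \<open>\<psi>\<close> of a real frame
  with the same index set, and vectors \<open>\<psi> x\<close> have real coordinates: this expresses
  that \<open>\<psi>\<close> complexifies to an isomorphism. By \<open>psi_wbr\<close> the two dual
  brackets have the same real structure constants.\<close>

locale real_form =
  R: framed_bracket "scaleR :: real \<Rightarrow> 'x::real_vector \<Rightarrow> 'x" UNIV I er cr brR +
  R: framed_dual "scaleR :: real \<Rightarrow> 'x::real_vector \<Rightarrow> 'x" UNIV I er cr WR pR wbrR wR +
  C: framed_bracket sc L I "\<lambda>i. \<psi> (er i)" cC brC +
  C: framed_dual sc L I "\<lambda>i. \<psi> (er i)" cC WC pC wbrC wC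
  for I :: "'i set" and er :: "'i \<Rightarrow> 'x::real_vector" and cr brR
    and WR :: "'r set" and pR wbrR wR
    and sc :: "complex \<Rightarrow> 'a::ab_group_add \<Rightarrow> 'a" and L and \<psi> :: "'x::real_vector \<Rightarrow> 'a" and cC brC
    and WC :: "'w set" and pC wbrC wC +
  assumes psi_mem: "\<psi> x \<in> L"
    and psi_add: "\<psi> (x + y) = \<psi> x + \<psi> y"
    and psi_scale: "\<psi> (r *\<^sub>R x) = sc (complex_of_real r) (\<psi> x)"
    and psi_br: "\<psi> (brR x y) = brC (\<psi> x) (\<psi> y)"
    and psi_coord: "i \<in> I \<Longrightarrow> cC i (\<psi> x) = complex_of_real (cr i x)"
    and psi_wbr: "i \<in> I \<Longrightarrow> j \<in> I \<Longrightarrow>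
      pC (wbrC (wC i) (wC j)) (\<psi> x) = complex_of_real (pR (wbrR (wR i) (wR j)) x)"
begin

text \<open>\<open>rp\<close> and \<open>ip\<close> are the real and imaginary parts of the pullback
  along \<open>\<psi>\<close>, kept apart because the elements of \<open>complexified_dga\<close>
  are pairs of real forms.\<close>

definition rp :: "('a list \<Rightarrow> complex) \<Rightarrow> 'x list \<Rightarrow> real" where
  "rp F = (\<lambda>xs. Re (F (map \<psi> xs)))"

definition ip :: "('a list \<Rightarrow> complex) \<Rightarrow> 'x list \<Rightarrow> real" where
  "ip F = (\<lambda>xs. Im (F (map \<psi> xs)))"

lemma rp_alt: "F \<in> C.Alt \<Longrightarrow> rp F \<in> R.Alt" and ip_alt: "F \<in> C.Alt \<Longrightarrow> ip F \<in> R.Alt"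
  by (rule R.alt_formsI; simp add: rp_def ip_def C.alt_adjacent C.alt_add_arg C.alt_scale_arg psi_mem psi_add psi_scale)+

lemma rp_homog: "homog p F \<Longrightarrow> homog p (rp F)" and ip_homog: "homog p F \<Longrightarrow> homog p (ip F)"
  by (simp_all add: homog_def rp_def ip_def)

lemma rp_contr: "rp (contr (\<psi> x) F) = contr x (rp F)" and ip_contr: "ip (contr (\<psi> x) F) = contr x (ip F)"
  by (simp_all add: rp_def ip_def contr_def)

lemma rp_sgnop: "rp (sgnop F) = sgnop (rp F)" and ip_sgnop: "ip (sgnop F) = sgnop (ip F)"
proof -
  have "Re ((- 1) ^ n * z) = (- 1) ^ n * Re z" "Im ((- 1) ^ n * z) = (- 1) ^ n * Im z" for n z
    by (cases "even n"; simp)+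
  then show "rp (sgnop F) = sgnop (rp F)" "ip (sgnop F) = sgnop (ip F)"
    by (simp_all add: rp_def ip_def sgnop_def)
qed

lemma rp_sum: "rp (\<lambda>xs. \<Sum>i\<in>S. F i xs) = (\<lambda>xs. \<Sum>i\<in>S. rp (F i) xs)"
  and ip_sum: "ip (\<lambda>xs. \<Sum>i\<in>S. F i xs) = (\<lambda>xs. \<Sum>i\<in>S. ip (F i) xs)"
  by (simp_all add: rp_def ip_def)

lemma rp_add: "rp (\<lambda>xs. F xs + G xs) = (\<lambda>xs. rp F xs + rp G xs)"
  and ip_add: "ip (\<lambda>xs. F xs + G xs) = (\<lambda>xs. ip F xs + ip G xs)"
  by (simp_all add: rp_def ip_def)

lemma rp_scale: "rp (\<lambda>xs. k * F xs) = (\<lambda>xs. Re k * rp F xs - Im k * ip F xs)"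
  and ip_scale: "ip (\<lambda>xs. k * F xs) = (\<lambda>xs. Re k * ip F xs + Im k * rp F xs)"
  by (simp_all add: rp_def ip_def)

lemma rp_ip_wedge:
  "rp (wedge F G) xs = wedge (rp F) (rp G) xs - wedge (ip F) (ip G) xs \<and>
   ip (wedge F G) xs = wedge (rp F) (ip G) xs + wedge (ip F) (rp G) xs"
proof (induction xs arbitrary: F G)
  case Nil
  then show ?case by (simp add: rp_def ip_def wedge_Nil)
next
  case (Cons x xs)
  have "rp (wedge F G) (x # xs) = rp (wedge (contr (\<psi> x) F) G) xs + rp (wedge (sgnop F) (contr (\<psi> x) G)) xs"
    "ip (wedge F G) (x # xs) = ip (wedge (contr (\<psi> x) F) G) xs + ip (wedge (sgnop F) (contr (\<psi> x) G)) xs"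
    by (simp_all add: rp_def ip_def wedge_Cons)
  then show ?case
    by (simp add: Cons rp_contr ip_contr rp_sgnop ip_sgnop wedge_Cons)
qed

lemma rp_wedge: "rp (wedge F G) = (\<lambda>xs. wedge (rp F) (rp G) xs - wedge (ip F) (ip G) xs)"
  and ip_wedge: "ip (wedge F G) = (\<lambda>xs. wedge (rp F) (ip G) xs + wedge (ip F) (rp G) xs)"
  using rp_ip_wedge by blast+

lemma rp_cf: "i \<in> I \<Longrightarrow> rp (C.cf i) = R.cf i" and ip_cf: "i \<in> I \<Longrightarrow> ip (C.cf i) = (\<lambda>_. 0)"
  by (auto simp: rp_def ip_def one_form_def psi_mem psi_coord fun_eq_iff split: list.split)

lemma rp_wform: "i \<in> I \<Longrightarrow> j \<in> I \<Longrightarrow> rp (C.wform i j) = R.wform i j"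
  and ip_wform: "i \<in> I \<Longrightarrow> j \<in> I \<Longrightarrow> ip (C.wform i j) = (\<lambda>_. 0)"
  by (auto simp: rp_def ip_def C.wform_def R.wform_def one_form_def psi_mem psi_wbr fun_eq_iff split: list.split)

lemma rp_dcf: "i \<in> I \<Longrightarrow> rp (C.dcf i) = R.dcf i" and ip_dcf: "i \<in> I \<Longrightarrow> ip (C.dcf i) = (\<lambda>_. 0)"
  by (auto simp: rp_def ip_def C.dcf_def R.dcf_def C.two_form_def R.two_form_def psi_mem psi_coord
      psi_br[symmetric] fun_eq_iff split: list.split)

text \<open>The coefficients \<open>dcf i\<close> pull back to real forms, so the explicit formula
  for the differential splits into real and imaginary parts. The bracket behaves likewise, with
  \<open>wform i j\<close> as coefficients.\<close>

lemma rp_ce: "rp (C.ce F) = R.ce (rp F)" and ip_ce: "ip (C.ce F) = R.ce (ip F)"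
  by (simp_all add: C.ce_def R.ce_def rp_sum ip_sum rp_wedge ip_wedge rp_dcf ip_dcf rp_contr ip_contr cong: sum.cong)

lemma rp_gb: "rp (C.gb F G) = (\<lambda>xs. R.gb (rp F) (rp G) xs - R.gb (ip F) (ip G) xs)"
  and ip_gb: "ip (C.gb F G) = (\<lambda>xs. R.gb (rp F) (ip G) xs + R.gb (ip F) (rp G) xs)"
  by (simp_all add: C.gb_def R.gb_def rp_sum ip_sum rp_wedge ip_wedge rp_wform ip_wform rp_contr ip_contr
      rp_sgnop ip_sgnop sum_subtractf sum.distrib cong: sum.cong)

section \<open>Bijectivity of the pullback\<close>

text \<open>The difference vanishes on all lists of frame vectors, because these are images under
  \<open>\<psi>\<close>.\<close>

lemma rp_ip_inject:
  assumes "F \<in> C.Alt" "G \<in> C.Alt" "rp F = rp G" "ip F = ip G"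
  shows "F = G"
proof (rule ext)
  fix xs
  have H: "(\<lambda>xs. F xs + - G xs) \<in> C.Alt" using assms by (intro C.alt_add C.alt_uminus)
  have "F xs + - G xs = 0"
  proof (rule C.alt_zeroI_frame[OF H])
    fix js
    have "F (map \<psi> (map er js)) = G (map \<psi> (map er js))"
      using fun_cong[OF assms(3), of "map er js"] fun_cong[OF assms(4), of "map er js"]
      by (simp add: rp_def ip_def complex_eq_iff)
    then show "F (map (\<lambda>i. \<psi> (er i)) js) + - G (map (\<lambda>i. \<psi> (er i)) js) = 0"
      by (simp add: o_def)
  qed
  then show "F xs = G xs" by simp
qed

text \<open>The coordinate forms on \<open>L\<close> pull back to the real coordinate forms, and
  these generate the real forms.\<close>

lemma real_alt_lift: "A \<in> R.Alt \<Longrightarrow> \<exists>F\<in>C.Alt. rp F = A \<and> ip F = (\<lambda>_. 0)"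
proof (induction A rule: R.euler_induct)
  case const
  show ?case
    by (rule bexI[of _ "const_form 1"]) (auto simp: rp_def ip_def const_form_def C.const_form_alt)
next
  case (wedge i A)
  then obtain F where "F \<in> C.Alt" "rp F = A" "ip F = (\<lambda>_. 0)" by blast
  then show ?case using wedge(1)
    by (intro bexI[of _ "wedge (C.cf i) F"])
      (simp_all add: rp_wedge ip_wedge rp_cf ip_cf C.alt_wedge C.cf_alt)
next
  case (sum S A)
  then have "\<forall>n\<in>S. \<exists>F. F \<in> C.Alt \<and> rp F = A n \<and> ip F = (\<lambda>_. 0)" by blast
  then obtain F where "\<And>n. n \<in> S \<Longrightarrow> F n \<in> C.Alt \<and> rp (F n) = A n \<and> ip (F n) = (\<lambda>_. 0)" by metis
  then show ?case
    by (intro bexI[of _ "\<lambda>xs. \<Sum>n\<in>S. F n xs"]) (simp_all add: rp_sum ip_sum C.alt_sum cong: sum.cong)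
next
  case (scale k A)
  then obtain F where "F \<in> C.Alt" "rp F = A" "ip F = (\<lambda>_. 0)" by blast
  then show ?case
    by (intro bexI[of _ "\<lambda>xs. complex_of_real k * F xs"]) (simp_all add: rp_scale ip_scale C.alt_scale)
qed

lemma bij_rp_ip: "bij_betw (\<lambda>F. (rp F, ip F)) C.Alt (R.Alt \<times> R.Alt)"
proof (rule bij_betwI')
  fix F G assume "F \<in> C.Alt" "G \<in> C.Alt"
  then show "((rp F, ip F) = (rp G, ip G)) = (F = G)" using rp_ip_inject by auto
next
  fix F assume "F \<in> C.Alt" then show "(rp F, ip F) \<in> R.Alt \<times> R.Alt" by (simp add: rp_alt ip_alt)
next
  fix z assume "z \<in> R.Alt \<times> R.Alt"
  then obtain A B where AB: "z = (A, B)" "A \<in> R.Alt" "B \<in> R.Alt" by auto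
  obtain F G where FG: "F \<in> C.Alt" "rp F = A" "ip F = (\<lambda>_. 0)" "G \<in> C.Alt" "rp G = B" "ip G = (\<lambda>_. 0)"
    using real_alt_lift[OF AB(2)] real_alt_lift[OF AB(3)] by blast
  let ?H = "\<lambda>xs. F xs + \<i> * G xs"
  have "?H \<in> C.Alt" using FG by (intro C.alt_add C.alt_scale)
  moreover have "z = (rp ?H, ip ?H)" using FG AB(1) by (simp add: rp_add ip_add rp_scale ip_scale)
  ultimately show "\<exists>F\<in>C.Alt. z = (rp F, ip F)" by blast
qed

text \<open>Differential and bracket enter \<open>exterior_dga\<close> through \<open>SOME\<close>.
  Existence and uniqueness replace them on forms by the explicit \<open>ce\<close> and
  \<open>gb\<close>, whose compatibility with the pullback is known.\<close>

theorem exterior_dga_isomorphic: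
  "dga_isomorphic (exterior_dga sc L brC WC pC wbrC)
     (complexified_dga (exterior_dga scaleR UNIV brR WR pR wbrR))"
proof -
  define DC where "DC = (SOME D. is_ce_differential sc L brC D)"
  define BC where "BC = (SOME B. is_gerstenhaber_bracket sc L WC pC wbrC B)"
  define DR where "DR = (SOME D. is_ce_differential (scaleR :: real \<Rightarrow> 'x \<Rightarrow> 'x) UNIV brR D)"
  define BR where "BR = (SOME B. is_gerstenhaber_bracket (scaleR :: real \<Rightarrow> 'x \<Rightarrow> 'x) UNIV WR pR wbrR B)"
  have DC: "DC F = C.ce F" if "F \<in> C.Alt" for F
    using C.ce_differential_unique[OF _ that] someI[of "is_ce_differential sc L brC", OF C.ce_is_ce_differential]
    by (simp add: DC_def)
  have DR: "DR F = R.ce F" if "F \<in> R.Alt" for F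
    using R.ce_differential_unique[OF _ that] someI[of "is_ce_differential scaleR UNIV brR", OF R.ce_is_ce_differential]
    by (simp add: DR_def)
  have BC: "BC F G = C.gb F G" if "F \<in> C.Alt" "G \<in> C.Alt" for F G
    using C.gerstenhaber_unique[OF _ that]
      someI[of "is_gerstenhaber_bracket sc L WC pC wbrC", OF C.gb_is_gerstenhaber]
    by (simp add: BC_def)
  have BR: "BR F G = R.gb F G" if "F \<in> R.Alt" "G \<in> R.Alt" for F G
    using R.gerstenhaber_unique[OF _ that]
      someI[of "is_gerstenhaber_bracket scaleR UNIV WR pR wbrR", OF R.gb_is_gerstenhaber]
    by (simp add: BR_def)
  show ?thesis
    unfolding dga_isomorphic_def exterior_dga_def complexified_dga_def complexified_mult_def
      DC_def[symmetric] DR_def[symmetric] BC_def[symmetric] BR_def[symmetric]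
    by (rule exI[of _ "\<lambda>F. (rp F, ip F)"])
      (auto simp: bij_rp_ip rp_alt ip_alt DC DR BC BR rp_add ip_add rp_scale ip_scale rp_wedge ip_wedge
        rp_ce ip_ce rp_gb ip_gb R.alt_deg_iff C.alt_deg_iff rp_homog ip_homog)
qed

end

section \<open>The Schouten bracket and the symplectic dual\<close>

lemma cbil_add:
  assumes "bilinear f"
  shows "cbil f (z + z') w = cbil f z w + cbil f z' w" "cbil f z (w + w') = cbil f z w + cbil f z w'"
  by (cases z; cases z'; cases w; simp add: bilinear_ladd[OF assms] bilinear_radd[OF assms])
    (cases z; cases w; cases w'; simp add: bilinear_ladd[OF assms] bilinear_radd[OF assms])

lemma cbil_scale:
  assumes "bilinear f"
  shows "cbil f (cscale k z) w = cscale k (cbil f z w)" "cbil f z (cscale k w) = cscale k (cbil f z w)"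
  by (cases z; cases w; simp add: bilinear_ladd[OF assms] bilinear_radd[OF assms] bilinear_lmul[OF assms] bilinear_rmul[OF assms]
      bilinear_lsub[OF assms] bilinear_rsub[OF assms] algebra_simps)+

lemma cscale_add: "cscale k (z + w) = cscale k z + cscale k w"
  by (cases z; cases w) (simp add: algebra_simps)

lemma cscale_diff: "cscale k (z - w) = cscale k z - cscale k w"
  by (cases z; cases w) (simp add: algebra_simps)

lemma bilinear_dual_app: "bilinear dual_app"
  by (rule bilinearI) (simp_all add: dual_app_add dual_app_scaleR linear_add[OF linear_dual_app] linear_scale[OF linear_dual_app])

lemma ceval_Pair: "ceval (a, b) (x, y) = Complex (dual_app a x - dual_app b y) (dual_app a y + dual_app b x)"
  by (simp add: ceval_def)

lemma ceval_add: "ceval (a + b) z = ceval a z + ceval b z" "ceval a (z + w) = ceval a z + ceval a w"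
  by (simp_all add: ceval_def cbil_add[OF bilinear_dual_app] split: prod.splits) (simp_all add: complex_eq_iff)

lemma ceval_scale: "ceval (cscale k a) z = k * ceval a z" "ceval a (cscale k z) = k * ceval a z"
  by (simp_all add: ceval_def cbil_scale[OF bilinear_dual_app] split: prod.splits) (simp_all add: complex_eq_iff)

lemma gen_pairing_eq: "gen_pairing z w = ceval (snd z) (fst w) + ceval (snd w) (fst z)"
  by (simp add: gen_pairing_def split_def)

lemma schouten_eq: "schouten br z w = (cbil br (fst z) (fst w),
    cbil (contract_d br) (fst z) (snd w) - cbil (contract_d br) (fst w) (snd z))"
  by (simp add: schouten_def split_def)

lemma gen_scale_add: "gen_scale k (z + w) = gen_scale k z + gen_scale k w"
  by (simp add: gen_scale_def cscale_add)

lemma gen_pairing_add: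
  "gen_pairing (z + z') w = gen_pairing z w + gen_pairing z' w"
  "gen_pairing z (w + w') = gen_pairing z w + gen_pairing z w'"
  by (simp_all add: gen_pairing_eq ceval_add)

lemma gen_pairing_scale:
  "gen_pairing (gen_scale k z) w = k * gen_pairing z w"
  "gen_pairing z (gen_scale k w) = k * gen_pairing z w"
  by (simp_all add: gen_pairing_eq gen_scale_def ceval_scale distrib_left)

lemma gen_scale_minus_one: "gen_scale (- 1) z = - z"
  by (cases z; cases "fst z"; cases "snd z") (simp add: gen_scale_def)

lemma dual_app_contract_d:
  assumes "bilinear br"
  shows "dual_app (contract_d br x \<alpha>) y = - dual_app \<alpha> (br x y)"
proof -
  have "linear (\<lambda>y. - dual_app \<alpha> (br x y))"
    by (intro linearI) (simp_all add: bilinear_radd[OF assms] bilinear_rmul[OF assms]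
        linear_add[OF linear_dual_app] linear_scale[OF linear_dual_app])
  then show ?thesis by (simp add: contract_d_def dual_app_Dual)
qed

lemma bilinear_contract_d:
  assumes "bilinear br" shows "bilinear (contract_d br)"
  by (rule bilinearI; rule dual_eqI)
    (simp_all add: dual_app_contract_d[OF assms] dual_app_add dual_app_scaleR bilinear_ladd[OF assms] bilinear_lmul[OF assms]
      linear_add[OF linear_dual_app] linear_scale[OF linear_dual_app])

lemma schouten_add:
  assumes "bilinear br"
  shows "schouten br (z + z') w = schouten br z w + schouten br z' w"
    "schouten br z (w + w') = schouten br z w + schouten br z w'"
  by (simp_all add: schouten_eq cbil_add[OF assms] cbil_add[OF bilinear_contract_d[OF assms]])

lemma schouten_scale:
  assumes "bilinear br"
  shows "schouten br (gen_scale k z) w = gen_scale k (schouten br z w)"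
    "schouten br z (gen_scale k w) = gen_scale k (schouten br z w)"
  by (simp_all add: schouten_eq gen_scale_def cbil_scale[OF assms] cbil_scale[OF bilinear_contract_d[OF assms]]
      cscale_diff)

lemma bilinear_alternating_anti:
  assumes "bilinear f" "\<And>x. f x x = 0"
  shows "f x y = - f y x"
proof -
  have "f x y + f y x = f (x + y) (x + y)"
    using assms(2)[of x] assms(2)[of y] by (simp add: bilinear_ladd[OF assms(1)] bilinear_radd[OF assms(1)])
  then show ?thesis by (simp only: assms(2) eq_neg_iff_add_eq_0)
qed

lemma schouten_self:
  assumes "bilinear br" "\<And>x. br x x = 0"
  shows "schouten br z z = 0"
proof -
  have "br x y + br y x = 0" for x y
    using bilinear_alternating_anti[OF assms, of x y] by simp
  then have "cbil br x x = 0" for x by (cases x) (simp add: assms(2) zero_prod_def)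
  then show ?thesis by (cases z) (simp add: schouten_def zero_prod_def)
qed

lemma schouten_anti:
  assumes "bilinear br" "\<And>x. br x x = 0"
  shows "schouten br z w = - schouten br w z"
proof -
  have "schouten br z w + schouten br w z = schouten br (z + w) (z + w)"
    using schouten_self[OF assms, of z] schouten_self[OF assms, of w]
    by (simp add: schouten_add[OF assms(1)])
  then show ?thesis by (simp only: schouten_self[OF assms] eq_neg_iff_add_eq_0)
qed

section \<open>Dual bases and the map given by a nondegenerate form\<close>

lemma linear_flat:
  assumes "bilinear \<omega>" shows "linear (flat \<omega>)" "dual_app (flat \<omega> x) y = \<omega> x y"
proof -
  have l: "linear (\<omega> x)" for x using assms by (simp add: bilinear_def)
  show a: "dual_app (flat \<omega> x) y = \<omega> x y" for x y by (simp add: flat_def dual_app_Dual l)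
  show "linear (flat \<omega>)"
    by (intro linearI; rule dual_eqI)
      (simp_all add: a dual_app_add dual_app_scaleR bilinear_ladd[OF assms] bilinear_lmul[OF assms])
qed

text \<open>\<open>d b\<close> reads off the coefficient of \<open>b\<close>. The expansion of
  vectors supplies the real frame used later; the expansion of covectors serves for
  \<open>bij_flat\<close> and for the dual bracket.\<close>

lemma fin_dim_dual_basis:
  assumes "fin_dim TYPE('k::real_vector)"
  obtains B :: "'k::real_vector set" and d :: "'k \<Rightarrow> 'k dual" where "finite B" "independent B" "span B = UNIV"
    "\<forall>x. (\<Sum>b\<in>B. dual_app (d b) x *\<^sub>R b) = x" "\<forall>a. (\<Sum>b\<in>B. dual_app a b *\<^sub>R d b) = a"
proof -
  obtain B :: "'k set" where B: "finite B" "independent B" "span B = UNIV"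
    using fin_dim_basis[OF assms] .
  define d where "d b = Dual (\<lambda>x. real_vector.representation B x b)" for b
  have d: "dual_app (d b) x = real_vector.representation B x b" for b x
  proof -
    have "linear (\<lambda>x. real_vector.representation B x b)"
      using B by (intro linearI) (auto simp: real_vector.representation_add real_vector.representation_scale)
    then show ?thesis by (simp add: d_def dual_app_Dual)
  qed
  have expand: "(\<Sum>b\<in>B. dual_app (d b) x *\<^sub>R b) = x" for x
    using real_vector.sum_representation_eq[of B x B] B by (auto simp: d)
  moreover have "(\<Sum>b\<in>B. dual_app a b *\<^sub>R d b) = a" for a
  proof (rule dual_eqI)
    fix x
    have "dual_app (\<Sum>b\<in>S. dual_app a b *\<^sub>R d b) x = (\<Sum>b\<in>S. dual_app a b * dual_app (d b) x)" for S
      by (induction S rule: infinite_finite_induct) (auto simp: dual_app_add dual_app_scaleR dual_app_0)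
    moreover have "dual_app a x = dual_app a (\<Sum>b\<in>B. dual_app (d b) x *\<^sub>R b)" by (simp only: expand)
    ultimately show "dual_app (\<Sum>b\<in>B. dual_app a b *\<^sub>R d b) x = dual_app a x"
      by (simp add: linear_sum[OF linear_dual_app] linear_scale[OF linear_dual_app] mult.commute)
  qed
  ultimately show ?thesis using that B by blast
qed

text \<open>Nondegeneracy gives injectivity, and a dimension count gives surjectivity.\<close>

lemma bij_flat:
  fixes \<omega> :: "'k::real_vector \<Rightarrow> 'k \<Rightarrow> real"
  assumes "bilinear \<omega>" "\<And>x. (\<And>y. \<omega> x y = 0) \<Longrightarrow> x = 0" "fin_dim TYPE('k)"
  shows "bij (flat \<omega>)"
proof -
  have inj: "inj (flat \<omega>)"
  proof (subst linear_injective_0[OF linear_flat(1)[OF assms(1)]], intro allI impI)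
    fix x assume "flat \<omega> x = 0"
    then show "x = 0" using linear_flat(2)[OF assms(1), of x] by (intro assms(2)) (simp add: dual_app_0)
  qed
  obtain B :: "'k set" and d :: "'k \<Rightarrow> 'k dual" where B: "finite B" "independent B" "span B = UNIV"
    and "\<forall>x. (\<Sum>b\<in>B. dual_app (d b) x *\<^sub>R b) = x"
    and d: "\<forall>a. (\<Sum>b\<in>B. dual_app a b *\<^sub>R d b) = a"
    using fin_dim_dual_basis[OF assms(3)] .
  have spn: "a \<in> span (d ` B)" for a
    by (subst d[rule_format, of a, symmetric]) (intro span_sum span_scale span_base imageI)
  have ind: "independent (flat \<omega> ` B)"
    using B(2) inj by (intro linear_independent_injective_image[OF linear_flat(1)[OF assms(1)]]) (auto intro: inj_on_subset)
  have cardB: "card (flat \<omega> ` B) = card B" using inj by (intro card_image) (auto intro: inj_on_subset)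
  have "a \<in> span (flat \<omega> ` B)" for a
  proof (rule ccontr)
    \<comment> \<open>Together with the images of \<open>B\<close>, \<open>a\<close> would give
      \<open>card B + 1\<close> independent covectors in the span of at most \<open>card B\<close>
      functionals \<open>d b\<close>.\<close>
    assume a: "a \<notin> span (flat \<omega> ` B)"
    then have "independent (insert a (flat \<omega> ` B))" using ind by (simp add: independent_insert)
    then have "card (insert a (flat \<omega> ` B)) \<le> card (d ` B)"
      using independent_span_bound[of "d ` B"] B(1) spn by blast
    also have "\<dots> \<le> card B" using B(1) by (rule card_image_le)
    finally show False using a B(1) cardB span_base[of a "flat \<omega> ` B"] by (auto simp: card_insert_if split: if_splits)
  qed
  then have "a \<in> flat \<omega> ` span B" for a
    using linear_span_image[OF linear_flat(1)[OF assms(1)], of B] by simp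
  then have "surj (flat \<omega>)" using B(3) by auto
  then show ?thesis using inj by (simp add: bij_def)
qed

section \<open>The map \<open>psi\<close> and the coordinates inverting it\<close>

definition dext :: "'v dual \<Rightarrow> ('g::real_vector \<times> 'v::real_vector) dual" where
  "dext u = Dual (\<lambda>z. dual_app u (snd z))"

definition dpull :: "('h \<Rightarrow> 'h) \<Rightarrow> 'h::real_vector dual \<Rightarrow> 'h dual" where
  "dpull J a = Dual (\<lambda>z. dual_app a (J z))"

definition drestr :: "('g::real_vector \<times> 'v::real_vector) dual \<Rightarrow> 'v dual" where
  "drestr a = Dual (\<lambda>v. dual_app a (0, v))"

lemma dual_app_dext:
  fixes z :: "'g::real_vector \<times> 'v::real_vector"
  shows "dual_app (dext u) z = dual_app u (snd z)"
proof -
  have "linear (\<lambda>z :: 'g \<times> 'v. dual_app u (snd z))"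
    by (intro linearI) (simp_all add: linear_add[OF linear_dual_app] linear_scale[OF linear_dual_app])
  then show ?thesis by (simp add: dext_def dual_app_Dual)
qed

lemma dext_add: "dext (u + v) = dext u + dext v"
  and dext_scale: "dext (r *\<^sub>R u) = r *\<^sub>R dext u"
  by (rule dual_eqI; simp add: dual_app_dext dual_app_add dual_app_scaleR)+

lemma dual_app_dpull: "linear J \<Longrightarrow> dual_app (dpull J a) z = dual_app a (J z)"
proof -
  assume "linear J"
  then have "linear (\<lambda>z. dual_app a (J z))"
    by (intro linearI) (simp_all add: linear_add linear_scale linear_add[OF linear_dual_app] linear_scale[OF linear_dual_app])
  then show ?thesis by (simp add: dpull_def dual_app_Dual)
qed

lemma dual_app_drestr: "dual_app (drestr a) v = dual_app a (0, v)"
proof -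
  have "linear (\<lambda>v. dual_app a (0, v))"
  proof (intro linearI)
    fix x y show "dual_app a (0, x + y) = dual_app a (0, x) + dual_app a (0, y)"
      by (simp add: linear_add[OF linear_dual_app, symmetric])
    fix r show "dual_app a (0, r *\<^sub>R x) = r *\<^sub>R dual_app a (0, x)"
      using linear_scale[OF linear_dual_app, of a r "(0, x)"] by simp
  qed
  then show ?thesis by (simp add: drestr_def dual_app_Dual)
qed

text \<open>
  Real and imaginary parts of \<open>(x + i J x) + (i/2) (u - i u \<circ> J)\<close>. The factor \<open>i/2\<close> is what makes the
  pairing with the conjugate map \<open>psi (-J)\<close> equal to \<open>omega_J J\<close> on the nose.
\<close>

definition psi :: "('g \<times> 'v \<Rightarrow> 'g \<times> 'v) \<Rightarrow> 'g::real_vector \<times> 'v::real_vector dual \<Rightarrow> ('g \<times> 'v) gen" where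
  "psi J k = (((fst k, 0), J (fst k, 0)), ((1/2) *\<^sub>R dpull J (dext (snd k)), (1/2) *\<^sub>R dext (snd k)))"

text \<open>For totally real \<open>J\<close>, \<open>re_coord\<close> and \<open>im_coord\<close>
  recover \<open>k\<close> and \<open>l\<close> from \<open>psi J k + i psi J l\<close>. On
  \<open>V\<close> the covector \<open>u \<circ> J\<close> vanishes, so restriction to
  \<open>V\<close> isolates \<open>u\<close>; the factor 2 undoes the 1/2 in \<open>psi\<close>, and
  the minus sign in \<open>im_coord\<close> undoes the product of the two factors i.\<close>

definition re_coord :: "('g::real_vector \<times> 'v::real_vector) gen \<Rightarrow> 'g \<times> 'v dual" where
  "re_coord z = (fst (fst (fst z)), 2 *\<^sub>R drestr (snd (snd z)))"

definition im_coord :: "('g::real_vector \<times> 'v::real_vector) gen \<Rightarrow> 'g \<times> 'v dual" where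
  "im_coord z = (fst (snd (fst z)), - 2 *\<^sub>R drestr (fst (snd z)))"

lemma drestr_add: "drestr (a + b) = drestr a + drestr b"
  and drestr_diff: "drestr (a - b) = drestr a - drestr b"
  and drestr_scale: "drestr (r *\<^sub>R a) = r *\<^sub>R drestr a"
  by (rule dual_eqI; simp add: dual_app_drestr dual_app_add dual_app_diff dual_app_scaleR)+

lemma re_im_coord_add: "re_coord (z + w) = re_coord z + re_coord w" "im_coord (z + w) = im_coord z + im_coord w"
  by (simp_all add: re_coord_def im_coord_def drestr_add algebra_simps)

lemma re_im_coord_scale:
  "re_coord (gen_scale k z) = Re k *\<^sub>R re_coord z - Im k *\<^sub>R im_coord z"
  "im_coord (gen_scale k z) = Re k *\<^sub>R im_coord z + Im k *\<^sub>R re_coord z"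
  by (cases z; cases "fst z"; cases "snd z";
      simp add: re_coord_def im_coord_def gen_scale_def drestr_add drestr_diff drestr_scale algebra_simps)+

lemma gen_scale_psi:
  assumes "linear J"
  shows "gen_scale (complex_of_real r) (psi J k) = psi J (r *\<^sub>R k)"
proof -
  have "dpull J (r *\<^sub>R a) = r *\<^sub>R dpull J a" for a
    by (rule dual_eqI) (simp add: dual_app_dpull[OF assms] dual_app_scaleR)
  moreover have "J (r *\<^sub>R x, 0) = r *\<^sub>R J (x, 0)" for x
    using linear_scale[OF assms, of r "(x, 0)"] by simp
  ultimately show ?thesis by (simp add: psi_def gen_scale_def dext_scale zero_prod_def)
qed

lemma psi_add:
  assumes "linear J" shows "psi J (k + l) = psi J k + psi J l"
proof -
  have "dpull J (a + b) = dpull J a + dpull J b" for a b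
    by (rule dual_eqI) (simp add: dual_app_dpull[OF assms] dual_app_add)
  moreover have "J (x + y, 0) = J (x, 0) + J (y, 0)" for x y
    using linear_add[OF assms, of "(x, 0)" "(y, 0)"] by simp
  ultimately show ?thesis by (simp add: psi_def dext_add algebra_simps)
qed

lemma gen_scale_Complex: "gen_scale (Complex r s) z = gen_scale (complex_of_real r) z + gen_scale \<i> (gen_scale (complex_of_real s) z)"
  by (cases z; cases "fst z"; cases "snd z") (simp add: gen_scale_def)

lemma gen_scale_zero: "gen_scale k 0 = 0"
  using gen_scale_add[of k 0 0] by simp

text \<open>Real linearity of \<open>psi J\<close> collects a complex combination of its values into
  one real and one imaginary element; this reduces complex frame expansions to real ones.\<close>

lemma sum_gen_scale_psi:
  assumes "linear J"
  shows "(\<Sum>i\<in>S. gen_scale (Complex (r i) (s i)) (psi J (k i))) =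
    psi J (\<Sum>i\<in>S. r i *\<^sub>R k i) + gen_scale \<i> (psi J (\<Sum>i\<in>S. s i *\<^sub>R k i))"
proof (induction S rule: infinite_finite_induct)
  case (insert i S)
  then show ?case
    by (simp add: psi_add[OF assms] gen_scale_add gen_scale_Complex[of "r i"] gen_scale_psi[OF assms])
qed (use psi_add[OF assms, of 0 0] in \<open>simp_all add: gen_scale_zero\<close>)

section \<open>Totally real structures\<close>

lemma dual_app_uminus: "dual_app (- a) x = - dual_app a x"
  by (simp add: uminus_dual.rep_eq)

text \<open>Changing the sign of \<open>J\<close> exchanges the two eigenspaces. Facts proved about
  \<open>f1bar\<close> for every totally real structure thus apply to \<open>f1\<close>.\<close>

lemma f1_eq_f1bar: "f1 J = f1bar (\<lambda>z. - J z)"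
proof -
  have n: "(a = - b) = (- a = b)" for a b :: "'b::real_vector" by auto
  have "map_prod J J z = cscale \<i> z \<longleftrightarrow> map_prod (\<lambda>z. - J z) (\<lambda>z. - J z) z = cscale (- \<i>) z" for z
    by (cases z) (auto simp: n minus_equation_iff)
  then have "h10 J = h01 (\<lambda>z. - J z)" by (simp add: h10_def h01_def)
  then show ?thesis by (simp add: f1_def f1bar_def hs01_def hs10_def)
qed

text \<open>\<open>J\<close> in block form: \<open>j\<close> carries the Lie algebra to
  \<open>V\<close>, and \<open>q\<close> is its inverse. Integrability is recorded as
  \<open>j_br\<close>. The description is stable under changing the signs of \<open>J\<close>,
  \<open>j\<close> and \<open>q\<close> together, which is \<open>conjugate\<close>.\<close>

locale totally_real_structure =
  fixes br :: "'g::real_vector \<Rightarrow> 'g \<Rightarrow> 'g" and \<rho> :: "'g \<Rightarrow> 'v::real_vector \<Rightarrow> 'v"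
    and J :: "'g \<times> 'v \<Rightarrow> 'g \<times> 'v" and j :: "'g \<Rightarrow> 'v" and q :: "'v \<Rightarrow> 'g"
  assumes lie: "lie_algebra br" and rep: "lie_representation br \<rho>"
    and J_eq: "J (x, v) = (- q v, j x)"
    and j_lin: "linear j" and q_lin: "linear q"
    and q_j: "q (j x) = x" and j_q: "j (q v) = v"
    and j_br: "j (br x y) = \<rho> x (j y) - \<rho> y (j x)"
begin

lemma J_lin: "linear J"
proof (rule linearI)
  fix z w show "J (z + w) = J z + J w"
    by (cases z; cases w) (simp add: J_eq linear_add[OF j_lin] linear_add[OF q_lin])
next
  fix r z show "J (r *\<^sub>R z) = r *\<^sub>R J z"
    by (cases z) (simp add: J_eq linear_scale[OF j_lin] linear_scale[OF q_lin])
qed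

lemma bil: "bilinear br" "bilinear \<rho>"
  using lie rep by (auto simp: lie_algebra_def lie_representation_def)

lemma sd_bil: "bilinear (semidirect br \<rho>)" and sd_same: "semidirect br \<rho> z z = 0"
  and dsd_bil: "bilinear (semidirect br (dual_rep \<rho>))" and dsd_same: "semidirect br (dual_rep \<rho>) k k = 0"
  using lie_algebra_semidirect[OF lie rep] lie_algebra_semidirect[OF lie lie_representation_dual_rep[OF lie rep]]
  unfolding lie_algebra_def by blast+

lemma J_J: "J (J z) = - z"
  by (cases z) (simp add: J_eq q_j j_q linear_neg[OF j_lin] linear_neg[OF q_lin])

lemmas lin_simps = linear_neg[OF j_lin] linear_neg[OF q_lin] linear_0[OF j_lin] linear_0[OF q_lin]
  linear_add[OF linear_dual_app] linear_diff[OF linear_dual_app]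
  linear_neg[OF linear_dual_app] linear_0[OF linear_dual_app]
  bilinear_lzero[OF bil(1)] bilinear_rzero[OF bil(1)] bilinear_lzero[OF bil(2)] bilinear_rzero[OF bil(2)]

lemmas dual_simps = dual_app_uminus dual_app_add dual_app_diff dual_app_scaleR dual_app_0 dual_app_dext
  dual_app_dpull[OF J_lin] dual_app_drestr
  dual_app_contract_d[OF sd_bil]

lemma dual_app_dual_rep: "dual_app (dual_rep \<rho> x a) u = - dual_app a (\<rho> x u)"
proof -
  have "linear (\<lambda>u. - dual_app a (\<rho> x u))"
    by (intro linearI) (auto simp: bilinear_radd[OF bil(2)] bilinear_rmul[OF bil(2)]
        linear_add[OF linear_dual_app] linear_scale[OF linear_dual_app])
  then show ?thesis by (simp add: dual_rep_def dual_app_Dual)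
qed

section \<open>The space \<open>f1bar J\<close> as the complex span of the image of
  \<open>psi J\<close>\<close>

lemma h01_iff: "(x, y) \<in> h01 J \<longleftrightarrow> y = J x"
  by (auto simp: h01_def J_J)

lemma hs10_iff: "(a, b) \<in> hs10 J \<longleftrightarrow> (\<forall>x. dual_app a x = dual_app b (J x))" 
proof -
  have "h01 J = range (\<lambda>x. (x, J x))" by (auto simp: h01_iff)
  then have "(a, b) \<in> hs10 J \<longleftrightarrow> (\<forall>x. dual_app a x = dual_app b (J x) \<and> dual_app a (J x) = - dual_app b x)"
    by (simp add: hs10_def ceval_Pair complex_eq_iff eq_neg_iff_add_eq_0 del: split_paired_All)
  \<comment> \<open>The second equation is the first one at \<open>J x\<close>.\<close>
  also have "\<dots> \<longleftrightarrow> (\<forall>x. dual_app a x = dual_app b (J x))"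
    by (metis J_J linear_neg[OF linear_dual_app])
  finally show ?thesis .
qed

lemma psi_mem: "psi J k \<in> f1bar J"
  by (simp add: f1bar_def psi_def h01_iff hs10_iff dual_simps)

text \<open>Membership means that the imaginary vector is \<open>J\<close> of the real one and that
  the real covector is the imaginary one composed with \<open>J\<close>; the parts that remain free
  are those read off by \<open>re_coord\<close> and \<open>im_coord\<close>.\<close>

lemma f1bar_decomp:
  assumes "z \<in> f1bar J"
  shows "psi J (re_coord z) + gen_scale \<i> (psi J (im_coord z)) = z"
proof -
  obtain x v y a b where z: "z = (((x, v), y), (a, b))" by (metis surj_pair)
  have y: "y = (- q v, j x)" using assms by (simp add: z f1bar_def h01_iff J_eq)
  have a: "dual_app a w = dual_app b (J w)" for w
    using assms by (simp add: z f1bar_def hs10_iff del: split_paired_All)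
  have sp: "dual_app b (s, t) = dual_app b (s, 0) + dual_app b (0, t)" for s t
    by (simp add: linear_add[OF linear_dual_app, symmetric])
  have ng: "dual_app b (- s, t) = - dual_app b (s, 0) + dual_app b (0, t)" for s t
    using sp[of "- s" t] linear_neg[OF linear_dual_app, of b "(s, 0)"] by simp
  have n0: "dual_app b (0, 0) = 0" using linear_0[OF linear_dual_app, of b] by (simp add: zero_prod_def)
  have "(1/2) *\<^sub>R dpull J (dext (2 *\<^sub>R drestr b)) - (1/2) *\<^sub>R dext (- 2 *\<^sub>R drestr a) = a"
  proof (rule dual_eqI)
    fix w show "dual_app ((1/2) *\<^sub>R dpull J (dext (2 *\<^sub>R drestr b)) - (1/2) *\<^sub>R dext (- 2 *\<^sub>R drestr a)) w = dual_app a w"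
      by (cases w) (simp add: dual_simps a J_eq lin_simps ng n0)
  qed
  moreover have "(1/2) *\<^sub>R dext (2 *\<^sub>R drestr b) + (1/2) *\<^sub>R dpull J (dext (- 2 *\<^sub>R drestr a)) = b"
  proof (rule dual_eqI)
    fix w show "dual_app ((1/2) *\<^sub>R dext (2 *\<^sub>R drestr b) + (1/2) *\<^sub>R dpull J (dext (- 2 *\<^sub>R drestr a))) w = dual_app b w"
      using sp[of "fst w" "snd w"] by (cases w) (simp add: dual_simps a J_eq lin_simps ng n0 q_j)
  qed
  ultimately show ?thesis
    by (simp add: z y psi_def re_coord_def im_coord_def gen_scale_def J_eq lin_simps j_q)
qed

lemma re_coord_psi: "re_coord (psi J k) = k" and im_coord_psi: "im_coord (psi J k) = 0"
proof -
  have "2 *\<^sub>R drestr ((1/2) *\<^sub>R (dext u :: ('g \<times> 'v) dual)) = u" for u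
    by (rule dual_eqI) (simp add: dual_simps)
  then show "re_coord (psi J k) = k" by (simp add: re_coord_def psi_def)
  have "- 2 *\<^sub>R drestr ((1/2) *\<^sub>R dpull J (dext u)) = 0" for u
    by (rule dual_eqI) (simp add: dual_simps J_eq lin_simps)
  then show "im_coord (psi J k) = 0" by (simp add: im_coord_def psi_def J_eq lin_simps zero_prod_def)
qed

lemma f1bar_add: "z \<in> f1bar J \<Longrightarrow> w \<in> f1bar J \<Longrightarrow> z + w \<in> f1bar J"
  by (cases z; cases w; cases "fst z"; cases "fst w"; cases "snd z"; cases "snd w")
    (auto simp: f1bar_def h01_iff hs10_iff linear_add[OF J_lin] dual_simps)

lemma f1bar_scale: "z \<in> f1bar J \<Longrightarrow> gen_scale k z \<in> f1bar J"
proof -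
  assume "z \<in> f1bar J"
  then obtain x a b where z: "z = ((x, J x), (a, b))" and ab: "\<And>w. dual_app a w = dual_app b (J w)"
    by (cases z; cases "fst z"; cases "snd z") (auto simp: f1bar_def h01_iff hs10_iff simp del: split_paired_All)
  show ?thesis
    by (simp add: z f1bar_def gen_scale_def h01_iff hs10_iff linear_add[OF J_lin] linear_diff[OF J_lin]
        linear_scale[OF J_lin] dual_simps lin_simps J_J ab algebra_simps del: split_paired_All)
qed

lemma f1bar_zero: "0 \<in> f1bar J"
  using f1bar_scale[OF psi_mem, of 0] by (simp add: gen_scale_def zero_prod_def psi_def J_eq)

text \<open>On vectors this is \<open>j_br\<close>. For covectors evaluated at
  \<open>(s, t)\<close>, the term with \<open>\<rho> s (j x)\<close> that \<open>j_br\<close>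
  produces from \<open>j (br x s)\<close> is cancelled by the contraction with
  \<open>J (x, 0)\<close>.\<close>

lemma psi_bracket: "psi J (semidirect br (dual_rep \<rho>) k l) = schouten (semidirect br \<rho>) (psi J k) (psi J l)"
proof (cases k; cases l)
  fix x u y v assume k: "k = (x, u)" and l: "l = (y, v)"
  \<comment> \<open>The real part of the covector component.\<close>
  have "(1/2) *\<^sub>R dpull J (dext (dual_rep \<rho> x v - dual_rep \<rho> y u)) =
     contract_d (semidirect br \<rho>) (x, 0) ((1/2) *\<^sub>R dpull J (dext v)) - contract_d (semidirect br \<rho>) (0, j x) ((1/2) *\<^sub>R dext v)
     - (contract_d (semidirect br \<rho>) (y, 0) ((1/2) *\<^sub>R dpull J (dext u)) - contract_d (semidirect br \<rho>) (0, j y) ((1/2) *\<^sub>R dext u))"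
  proof (rule dual_eqI)
    fix w show "dual_app ((1/2) *\<^sub>R dpull J (dext (dual_rep \<rho> x v - dual_rep \<rho> y u))) w = dual_app (contract_d (semidirect br \<rho>) (x, 0) ((1/2) *\<^sub>R dpull J (dext v)) - contract_d (semidirect br \<rho>) (0, j x) ((1/2) *\<^sub>R dext v)
     - (contract_d (semidirect br \<rho>) (y, 0) ((1/2) *\<^sub>R dpull J (dext u)) - contract_d (semidirect br \<rho>) (0, j y) ((1/2) *\<^sub>R dext u))) w"
      by (cases w) (simp add: dual_simps J_eq lin_simps dual_app_dual_rep j_br algebra_simps)
  qed
  \<comment> \<open>The imaginary part of the covector component.\<close>
  moreover have "(1/2) *\<^sub>R dext (dual_rep \<rho> x v - dual_rep \<rho> y u) =
     contract_d (semidirect br \<rho>) (x, 0) ((1/2) *\<^sub>R dext v) + contract_d (semidirect br \<rho>) (0, j x) ((1/2) *\<^sub>R dpull J (dext v))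
     - (contract_d (semidirect br \<rho>) (y, 0) ((1/2) *\<^sub>R dext u) + contract_d (semidirect br \<rho>) (0, j y) ((1/2) *\<^sub>R dpull J (dext u)))"
  proof (rule dual_eqI)
    fix w show "dual_app ((1/2) *\<^sub>R dext (dual_rep \<rho> x v - dual_rep \<rho> y u)) w = dual_app (contract_d (semidirect br \<rho>) (x, 0) ((1/2) *\<^sub>R dext v) + contract_d (semidirect br \<rho>) (0, j x) ((1/2) *\<^sub>R dpull J (dext v))
     - (contract_d (semidirect br \<rho>) (y, 0) ((1/2) *\<^sub>R dext u) + contract_d (semidirect br \<rho>) (0, j y) ((1/2) *\<^sub>R dpull J (dext u)))) w"
      by (cases w) (simp add: dual_simps J_eq lin_simps dual_app_dual_rep j_br algebra_simps)
  qed
  ultimately show ?thesis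
    by (simp add: k l psi_def schouten_def J_eq lin_simps j_br)
qed

text \<open>The bracket is complex bilinear, and \<open>psi J\<close> is a homomorphism whose values
  span \<open>f1bar J\<close> over the complex numbers.\<close>

lemma schouten_mem:
  assumes "z \<in> f1bar J" "w \<in> f1bar J"
  shows "schouten (semidirect br \<rho>) z w \<in> f1bar J"
proof -
  have "schouten (semidirect br \<rho>) (psi J a + gen_scale \<i> (psi J b)) (psi J c + gen_scale \<i> (psi J d)) \<in> f1bar J" for a b c d
    by (simp add: schouten_add[OF sd_bil] schouten_scale[OF sd_bil] psi_bracket[symmetric] f1bar_add f1bar_scale psi_mem)
  then show ?thesis by (metis f1bar_decomp assms)
qed

lemma conjugate: "totally_real_structure br \<rho> (\<lambda>z. - J z) (\<lambda>x. - j x) (\<lambda>v. - q v)"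
  by (rule totally_real_structure.intro)
    (simp_all add: lie rep J_eq linear_compose_neg j_lin q_lin linear_neg[OF j_lin] linear_neg[OF q_lin] q_j j_q j_br
      bilinear_rneg[OF bil(2)])

text \<open>With \<open>k = (x, u)\<close> and \<open>l = (y, v)\<close>, the covector of the first
  element at the vector of the second gives two equal terms, which the factor i/2 combines to
  \<open>- u (j y)\<close>; the other half gives \<open>v (j x)\<close> in the same way.\<close>

lemma pairing_psi: "gen_pairing (psi (\<lambda>z. - J z) k) (psi J l) = complex_of_real (omega_J J k l)"
proof -
  interpret c: totally_real_structure br \<rho> "\<lambda>z. - J z" "\<lambda>x. - j x" "\<lambda>v. - q v" by (rule conjugate)
  show ?thesis
    by (cases k; cases l)
      (simp add: gen_pairing_eq psi_def ceval_Pair dual_simps c.dual_simps J_eq lin_simps complex_eq_iff)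
qed

end

section \<open>The block form of a totally real structure\<close>

text \<open>Total reality makes \<open>j\<close> onto, and \<open>J (J z) = - z\<close> makes
  \<open>q\<close> its inverse.\<close>

lemma totally_real_structureI:
  assumes "lie_algebra br" "lie_representation br \<rho>" "complex_structure J"
    "integrable_wrt (semidirect br \<rho>) J" "totally_real J"
  obtains j q where "totally_real_structure br \<rho> J j q"
proof -
  define j where "j x = snd (J (x, 0))" for x
  define q where "q v = - fst (J (0, v))" for v
  have b: "bilinear \<rho>" "bilinear br" using assms by (auto simp: lie_representation_def lie_algebra_def)
  have lJ: "linear J" and J2: "J (J z) = - z" for z
    using assms(3) by (auto simp: complex_structure_def simp del: split_paired_All)
  have J1: "J (x, 0) = (0, j x)" for x
  proof -
    have "J (x, 0) \<in> {0} \<times> UNIV" using assms(5) unfolding totally_real_def by blast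
    then show ?thesis unfolding j_def by auto
  qed
  have surj: "\<exists>x. v = j x" for v
  proof -
    have "(0, v) \<in> J ` (UNIV \<times> {0})" using assms(5) unfolding totally_real_def by simp
    then show ?thesis using J1 by auto
  qed
  have J3: "J (0, j x) = (- x, 0)" for x using J2[of "(x, 0)"] by (simp add: J1)
  have qj: "q (j x) = x" for x by (simp add: q_def J3)
  have jq: "j (q v) = v" for v using surj[of v] qj by auto
  have J4: "J (0, v) = (- q v, 0)" for v using J3[of "q v"] by (simp add: jq)
  have Jeq: "J (x, v) = (- q v, j x)" for x v
    using linear_add[OF lJ, of "(x, 0)" "(0, v)"] by (simp add: J1 J4)
  have lj: "linear j"
  proof (rule linearI)
    fix x y show "j (x + y) = j x + j y"
      using linear_add[OF lJ, of "(x, 0)" "(y, 0)"] by (simp add: J1)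
    fix r show "j (r *\<^sub>R x) = r *\<^sub>R j x"
      using linear_scale[OF lJ, of r "(x, 0)"] by (simp add: J1)
  qed
  have lq: "linear q"
  proof (rule linearI)
    fix x y show "q (x + y) = q x + q y"
      using linear_add[OF lj, of "q x" "q y"] qj[of "q x + q y"] by (simp add: jq)
    fix r show "q (r *\<^sub>R x) = r *\<^sub>R q x"
      using linear_scale[OF lj, of r "q x"] qj[of "r *\<^sub>R q x"] by (simp add: jq)
  qed
  note z0 = bilinear_lzero[OF b(1)] bilinear_rzero[OF b(1)] bilinear_lzero[OF b(2)] bilinear_rzero[OF b(2)]
  have key: "j (br x y) = \<rho> x (j y) - \<rho> y (j x)" for x y
  proof -
    have "semidirect br \<rho> (x, 0) (y, 0) - semidirect br \<rho> (J (x, 0)) (J (y, 0))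
      + J (semidirect br \<rho> (x, 0) (J (y, 0)) + semidirect br \<rho> (J (x, 0)) (y, 0)) = 0"
      using assms(4) unfolding integrable_wrt_def by blast
    \<comment> \<open>\<open>J (x, 0)\<close> and \<open>J (y, 0)\<close> lie in the abelian ideal
      \<open>V\<close>, so their bracket drops out; the mixed brackets lie in \<open>V\<close>,
      where \<open>J\<close> acts as \<open>- q\<close>.\<close>
    then have "br x y = q (\<rho> x (j y) - \<rho> y (j x))" by (simp add: Jeq z0 zero_prod_def linear_0[OF lj] linear_0[OF lq])
    then show ?thesis by (simp add: jq)
  qed
  have "totally_real_structure br \<rho> J j q"
    using assms(1,2) Jeq lj lq qj jq key by (rule totally_real_structure.intro)
  then show ?thesis by (rule that)
qed

section \<open>Matching frames and the isomorphism\<close>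

lemma complex_linear_sum:
  assumes "\<And>z w. f (z + w) = f z + f w" "\<And>k z. f (gen_scale k z) = k * (f z :: complex)"
  shows "f (\<Sum>i\<in>S. gen_scale (k i) (z i)) = (\<Sum>i\<in>S. k i * f (z i))"
proof -
  have "f 0 = 0" using assms(1)[of 0 0] by simp
  then show ?thesis by (induction S rule: infinite_finite_induct) (simp_all add: assms)
qed

context totally_real_structure
begin

text \<open>A basis \<open>B\<close> of the dual semi-direct product and its image under
  \<open>psi J\<close> are the matching frames that \<open>real_form\<close> asks for.\<close>

lemma isomorphic:
  "dga_isomorphic (DGA_complex (semidirect br \<rho>) J) (DGA_symplectic (semidirect br (dual_rep \<rho>)) (omega_J J))"
  if sympl: "symplectic_form (semidirect br (dual_rep \<rho>)) (omega_J J)"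
proof -
  let ?\<omega> = "omega_J J"
  let ?sd = "semidirect br \<rho>"
  let ?dsd = "semidirect br (dual_rep \<rho>)"
  interpret c: totally_real_structure br \<rho> "\<lambda>z. - J z" "\<lambda>x. - j x" "\<lambda>v. - q v" by (rule conjugate)
  have \<omega>_bil: "bilinear ?\<omega>" and nondeg: "(\<And>y. ?\<omega> x y = 0) \<Longrightarrow> x = 0" for x
    using sympl unfolding symplectic_form_def by blast+
  have fin: "fin_dim TYPE('g \<times> 'v dual)"
    using lie rep by (intro fin_dim_prod fin_dim_dual) (auto simp: lie_algebra_def lie_representation_def)
  obtain B :: "('g \<times> 'v dual) set" and d :: "'g \<times> 'v dual \<Rightarrow> ('g \<times> 'v dual) dual"
    where B: "finite B" "independent B" "span B = UNIV" and d_expand_all: "\<forall>x. (\<Sum>b\<in>B. dual_app (d b) x *\<^sub>R b) = x"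
      and dual_expand_all: "\<forall>a. (\<Sum>b\<in>B. dual_app a b *\<^sub>R d b) = a"
    using fin_dim_dual_basis[OF fin] .
  note d_expand = d_expand_all[rule_format] and dual_expand = dual_expand_all[rule_format]
  note flat_lin = linear_flat(1)[OF \<omega>_bil] and flat_app = linear_flat(2)[OF \<omega>_bil]
  have flat_bij: "bij (flat ?\<omega>)" using \<omega>_bil nondeg fin by (rule bij_flat)
  define s where "s = inv (flat ?\<omega>)"
  have flat_s: "flat ?\<omega> (s a) = a" for a using flat_bij by (simp add: s_def surj_f_inv_f bij_is_surj)
  have s_flat: "s (flat ?\<omega> x) = x" for x using flat_bij by (simp add: s_def bij_is_inj)
  have s_app: "?\<omega> (s a) x = dual_app a x" for a x using flat_app[of "s a" x] by (simp add: flat_s)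
  have s_lin: "linear s"
    by (rule linearI) (metis flat_s s_flat linear_add[OF flat_lin], metis flat_s s_flat linear_scale[OF flat_lin])
  \<comment> \<open>Expanding the covector \<open>flat ?\<omega> k\<close> in the \<open>d b\<close>
    and applying \<open>s\<close> gives values of the symplectic form as coefficients.\<close>
  have s_expand: "k = (\<Sum>b\<in>B. ?\<omega> k b *\<^sub>R s (d b))" for k
    using arg_cong[OF dual_expand[of "flat ?\<omega> k", symmetric], of s]
    by (simp add: s_flat flat_app linear_sum[OF s_lin] linear_scale[OF s_lin])
  have ob: "dual_app (omega_bracket ?dsd ?\<omega> a b) x = ?\<omega> (?dsd (s a) (s b)) x" for a b x
    by (simp add: omega_bracket_def flat_app s_def)
  have ob_bil: "bilinear (\<lambda>a b. ?\<omega> (?dsd (s a) (s b)) x)" for x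
    by (rule bilinearI)
      (simp_all add: linear_add[OF s_lin] linear_scale[OF s_lin] bilinear_ladd[OF dsd_bil] bilinear_radd[OF dsd_bil]
        bilinear_lmul[OF dsd_bil] bilinear_rmul[OF dsd_bil] bilinear_ladd[OF \<omega>_bil] bilinear_lmul[OF \<omega>_bil])
  have dsd_anti: "?dsd k l = - ?dsd l k" for k l
    using dsd_bil dsd_same by (rule bilinear_alternating_anti)
  define cC where "cC b z = Complex (dual_app (d b) (re_coord z)) (dual_app (d b) (im_coord z))" for b z
  \<comment> \<open>By \<open>pairing_psi\<close> and \<open>s_app\<close> this element of
    \<open>f1 J\<close> pairs with \<open>psi J l\<close> to \<open>dual_app (d b) l\<close>, so it
    represents the coordinate \<open>cC b\<close>.\<close>
  define wC where "wC b = psi (\<lambda>z. - J z) (s (d b))" for b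
  \<comment> \<open>The counterpart of \<open>s_expand\<close> in \<open>f1 J\<close>, with pairings
    as coefficients. It reduces the Schouten bracket to its values on the
    \<open>wC b\<close>.\<close>
  have f1_expand: "u = (\<Sum>b\<in>B. gen_scale (gen_pairing u (psi J b)) (wC b))" if u: "u \<in> f1 J" for u
  proof -
    obtain k l where kl: "u = psi (\<lambda>z. - J z) k + gen_scale \<i> (psi (\<lambda>z. - J z) l)"
      using c.f1bar_decomp[of u] u by (metis f1_eq_f1bar)
    have "gen_pairing u (psi J b) = Complex (?\<omega> k b) (?\<omega> l b)" for b
      by (simp add: kl gen_pairing_add gen_pairing_scale pairing_psi complex_eq_iff)
    then show ?thesis
      using s_expand[of k] s_expand[of l] by (simp add: wC_def sum_gen_scale_psi[OF c.J_lin] kl)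
  qed
  have psi_coord: "cC b (psi J k) = complex_of_real (dual_app (d b) k)" for b k
    by (simp add: linear_0[OF linear_dual_app] cC_def re_coord_psi im_coord_psi complex_eq_iff)
  interpret R: scaled_carrier "scaleR :: real \<Rightarrow> 'g \<times> 'v dual \<Rightarrow> 'g \<times> 'v dual" UNIV
    by unfold_locales simp_all
  interpret R: framed_bracket "scaleR :: real \<Rightarrow> 'g \<times> 'v dual \<Rightarrow> 'g \<times> 'v dual" UNIV B "\<lambda>b. b" "\<lambda>b. dual_app (d b)" ?dsd
  proof unfold_locales
    show "R.lin_form (dual_app (d b))" for b
      by (simp add: R.lin_form_def linear_add[OF linear_dual_app] linear_scale[OF linear_dual_app] del: split_paired_All)
  qed (simp_all only: UNIV_I B(1) d_expand dsd_same bilinear_ladd[OF dsd_bil] bilinear_radd[OF dsd_bil]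
      bilinear_lmul[OF dsd_bil] bilinear_rmul[OF dsd_bil])
  interpret R: framed_dual "scaleR :: real \<Rightarrow> 'g \<times> 'v dual \<Rightarrow> 'g \<times> 'v dual" UNIV B "\<lambda>b. b" "\<lambda>b. dual_app (d b)"
    UNIV dual_app "omega_bracket ?dsd ?\<omega>" d
  proof unfold_locales
    show "R.lin_form (dual_app a)" for a
      by (simp add: R.lin_form_def linear_add[OF linear_dual_app] linear_scale[OF linear_dual_app] del: split_paired_All)
    fix a b x
    show "dual_app (omega_bracket ?dsd ?\<omega> a b) x = - dual_app (omega_bracket ?dsd ?\<omega> b a) x"
      unfolding ob by (subst dsd_anti) (rule bilinear_lneg[OF \<omega>_bil])
    have "dual_app (omega_bracket ?dsd ?\<omega> a b) x
        = ?\<omega> (?dsd (s (\<Sum>i\<in>B. dual_app a i *\<^sub>R d i)) (s (\<Sum>k\<in>B. dual_app b k *\<^sub>R d k))) x"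
      by (simp only: ob dual_expand)
    also have "\<dots> = (\<Sum>i\<in>B. \<Sum>k\<in>B. dual_app a i * dual_app b k * ?\<omega> (?dsd (s (d i)) (s (d k))) x)"
      by (simp add: bilinear_sum[OF ob_bil] sum.cartesian_product bilinear_lmul[OF ob_bil] bilinear_rmul[OF ob_bil]
          mult.assoc mult.left_commute split_def)
    finally show "dual_app (omega_bracket ?dsd ?\<omega> a b) x =
      (\<Sum>i\<in>B. \<Sum>k\<in>B. dual_app a i * dual_app b k * dual_app (omega_bracket ?dsd ?\<omega> (d i) (d k)) x)"
      by (simp only: ob)
  qed simp_all
  interpret C: scaled_carrier gen_scale "f1bar J"
    by unfold_locales (simp_all add: f1bar_zero f1bar_add f1bar_scale)
  interpret C: framed_bracket gen_scale "f1bar J" B "psi J" cC "schouten ?sd"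
  proof unfold_locales
    show "C.lin_form (cC b)" for b
      by (simp add: C.lin_form_def cC_def re_im_coord_add re_im_coord_scale linear_add[OF linear_dual_app]
          linear_diff[OF linear_dual_app] linear_scale[OF linear_dual_app] complex_eq_iff del: split_paired_All)
    show "(\<Sum>b\<in>B. gen_scale (cC b z) (psi J b)) = z" if "z \<in> f1bar J" for z
      unfolding cC_def sum_gen_scale_psi[OF J_lin] d_expand by (rule f1bar_decomp[OF that])
  qed (simp_all only: B(1) psi_mem schouten_mem schouten_self[OF sd_bil sd_same] schouten_add[OF sd_bil]
      schouten_scale[OF sd_bil])
  interpret C: framed_dual gen_scale "f1bar J" B "psi J" cC "f1 J" gen_pairing "schouten ?sd" wC
  proof unfold_locales
    show "wC b \<in> f1 J" for b unfolding wC_def f1_eq_f1bar by (rule c.psi_mem)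
    show "C.lin_form (gen_pairing u)" for u
      by (simp add: C.lin_form_def gen_pairing_add gen_pairing_scale del: split_paired_All)
    show "schouten ?sd u v \<in> f1 J" if "u \<in> f1 J" "v \<in> f1 J" for u v
      using that unfolding f1_eq_f1bar by (rule c.schouten_mem)
    show "gen_pairing (wC b) z = cC b z" if "z \<in> f1bar J" for b z
    proof -
      have "gen_pairing (wC b) (psi J (re_coord z) + gen_scale \<i> (psi J (im_coord z))) = cC b z"
        by (simp add: wC_def gen_pairing_add gen_pairing_scale pairing_psi s_app cC_def complex_eq_iff)
      then show ?thesis by (simp only: f1bar_decomp[OF that])
    qed
    fix u v x assume uv: "u \<in> f1 J" "v \<in> f1 J"
    show "gen_pairing (schouten ?sd u v) x = - gen_pairing (schouten ?sd v u) x"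
      using gen_pairing_scale(1)[of "- 1" "schouten ?sd v u" x] schouten_anti[OF sd_bil sd_same, of u v]
      by (simp add: gen_scale_minus_one)
    let ?P = "\<lambda>u v. gen_pairing (schouten ?sd u v) x"
    have left: "?P u v = (\<Sum>i\<in>B. gen_pairing u (psi J i) * ?P (wC i) v)"
      by (subst f1_expand[OF uv(1)], rule complex_linear_sum)
        (simp_all add: schouten_add[OF sd_bil] schouten_scale[OF sd_bil] gen_pairing_add gen_pairing_scale)
    have right: "?P w v = (\<Sum>k\<in>B. gen_pairing v (psi J k) * ?P w (wC k))" for w
      by (subst f1_expand[OF uv(2)], rule complex_linear_sum)
        (simp_all add: schouten_add[OF sd_bil] schouten_scale[OF sd_bil] gen_pairing_add gen_pairing_scale)
    show "?P u v = (\<Sum>i\<in>B. \<Sum>k\<in>B. gen_pairing u (psi J i) * gen_pairing v (psi J k) * ?P (wC i) (wC k))"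
      by (subst left) (simp add: right sum_distrib_left mult.assoc)
  qed
  interpret real_form B "\<lambda>b. b" "\<lambda>b. dual_app (d b)" ?dsd UNIV dual_app "omega_bracket ?dsd ?\<omega>" d
    gen_scale "f1bar J" "psi J" cC "schouten ?sd" "f1 J" gen_pairing "schouten ?sd" wC
  proof unfold_locales
    fix b k x
    \<comment> \<open>The map \<open>psi\<close> for \<open>- J\<close> is a homomorphism as well,
      so \<open>pairing_psi\<close> turns the Schouten bracket of these elements into the bracket
      defined by the symplectic form.\<close>
    have "schouten ?sd (wC b) (wC k) = psi (\<lambda>z. - J z) (?dsd (s (d b)) (s (d k)))"
      by (simp only: wC_def c.psi_bracket)
    then show "gen_pairing (schouten ?sd (wC b) (wC k)) (psi J x) =
      complex_of_real (dual_app (omega_bracket ?dsd ?\<omega> (d b) (d k)) x)"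
      by (simp only: pairing_psi ob)
  qed (simp_all only: psi_mem psi_add[OF J_lin] gen_scale_psi[OF J_lin] psi_bracket psi_coord)
  show ?thesis unfolding DGA_complex_def DGA_symplectic_def by (rule exterior_dga_isomorphic)
qed

end

theorem theorem4p1:
  fixes br :: "'g::real_vector \<Rightarrow> 'g \<Rightarrow> 'g"
    and \<rho> :: "'g \<Rightarrow> 'v::real_vector \<Rightarrow> 'v"
    and J :: "'g \<times> 'v \<Rightarrow> 'g \<times> 'v"
  assumes "lie_algebra br"
    and "lie_representation br \<rho>"
    and "complex_structure J"
    and "integrable_wrt (semidirect br \<rho>) J"
    and "totally_real J"
  shows "dga_isomorphic
           (DGA_complex (semidirect br \<rho>) J)
           (DGA_symplectic (semidirect br (dual_rep \<rho>)) (omega_J J))"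
proof -
  obtain j q where "totally_real_structure br \<rho> J j q"
    using totally_real_structureI[OF assms] .
  then show ?thesis
    using symplectic_form_omega_J[OF assms] by (rule totally_real_structure.isomorphic)
qed

end
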